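(* Let $d\ge 1$ be an integer and consider the metric space $(\mathbb{R}^d,\|\cdot\|_2)$, with Lebesgue measure $\lambda$. If $d\in\{1,2\}$, then Lebesgue measure is the unique doubling minimizer up to scalar multiples, i.e. $\mathrm{DM}(\mathbb{R}^d,\|\cdot\|_2)=\{\alpha\lambda:\alpha>0\}$. If $d\ge 3$, then the set of doubling minimizers $\mathrm{DM}(\mathbb{R}^d,\|\cdot\|_2)$ is an infinite-dimensional cone.
   Context: For a metric space $(X,d)$, write $B(x,r)=\{y\in X: d(y,x)<r\}$. A Borel regular measure $\mu$ on $X$ is doubling if there is a constant $C>0$ with $\mu(B(x,2r))\le C\mu(B(x,r))$ for all $x\in X$, $r>0$, and $0<\mu(B(x_0,r_0))<\infty$ for some $x_0\in X$, $r_0>0$ (then $0<\mu(B(x,r))<\infty$ for all $x\in X$, $r>0$). Its doubling constant is $C_\mu=\sup_{x\in X,\,r>0}\mu(B(x,2r))/\mu(B(x,r))$. The least doubling constant of $X$ is $C_X=\inf_\mu C_\mu$, the infimum being over all doubling measures on $X$. The set of doubling minimizers is $\mathrm{DM}(X,d)=\{\mu \text{ doubling measure on } X: C_\mu=C_X\}$. A cone of measures is a set closed under sums and under multiplication by positive scalars; it is infinite-dimensional if it contains infinitely many linearly independent measures (a finite family of such measures being linearly independent if no nontrivial real linear combination of them vanishes on all bounded Borel sets). *)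

theory Defs
  imports "HOL-Analysis.Analysis"
begin

(* A Borel regular (outer) measure is the same thing as a measure on the Borel
   sigma-algebra: the outer measure outer_measure_of M is Borel regular by
   outer_measure_of_attain and agrees with M on Borel sets, and a Borel regular outer
   measure is determined by its values on Borel sets. Hence the condition
   sets M = sets borel below. *)

definition doubling_measure :: "'a::metric_space measure \<Rightarrow> bool" where
  "doubling_measure M \<longleftrightarrow>
     sets M = sets borel \<and>
     (\<exists>C::real. C > 0 \<and>
        (\<forall>x r. r > 0 \<longrightarrow> emeasure M (ball x (2 * r)) \<le> ennreal C * emeasure M (ball x r))) \<and>
     (\<exists>x0 r0. r0 > 0 \<and> 0 < emeasure M (ball x0 r0) \<and> emeasure M (ball x0 r0) < \<infinity>)"

(* For a doubling measure all balls have positive finite measure, so the conventions of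
   ennreal division at 0 and at infinity play no role. *)
definition doubling_constant :: "'a::metric_space measure \<Rightarrow> ennreal" where
  "doubling_constant M =
     (SUP (x, r) \<in> UNIV \<times> {0<..}. emeasure M (ball x (2 * r)) / emeasure M (ball x r))"

definition least_doubling_constant :: "'a::metric_space itself \<Rightarrow> ennreal" where
  "least_doubling_constant TYPE('a) =
     (INF M \<in> {M :: 'a measure. doubling_measure M}. doubling_constant M)"

definition doubling_minimizers :: "'a::metric_space measure set" where
  "doubling_minimizers =
     {M. doubling_measure M \<and> doubling_constant M = least_doubling_constant TYPE('a)}"

(* Meaningful for measures on the same sigma-algebra. *)
definition add_measure :: "'a measure \<Rightarrow> 'a measure \<Rightarrow> 'a measure" where
  "add_measure M N = measure_of (space M) (sets M) (\<lambda>A. emeasure M A + emeasure N A)"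

lemma space_add_measure [simp]: "space (add_measure M N) = space M"
  by (simp add: add_measure_def)

lemma sets_add_measure [simp, measurable_cong]: "sets (add_measure M N) = sets M"
  by (simp add: add_measure_def)

lemma emeasure_add_measure:
  assumes "sets N = sets M" and "A \<in> sets M"
  shows "emeasure (add_measure M N) A = emeasure M A + emeasure N A"
proof (rule emeasure_measure_of[OF add_measure_def])
  show "sets M \<subseteq> Pow (space M)"
    by (rule sets.space_closed)
  show "A \<in> sets (add_measure M N)"
    using assms by simp
  show "positive (sets (add_measure M N)) (\<lambda>A. emeasure M A + emeasure N A)"
    by (simp add: positive_def)
  show "countably_additive (sets (add_measure M N)) (\<lambda>A. emeasure M A + emeasure N A)"
  proof (rule countably_additiveI)
    fix F :: "nat \<Rightarrow> 'a set"
    assume F: "range F \<subseteq> sets (add_measure M N)" "disjoint_family F"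
    have "(\<Sum>i. emeasure M (F i) + emeasure N (F i)) = (\<Sum>i. emeasure M (F i)) + (\<Sum>i. emeasure N (F i))"
      by (rule suminf_add[symmetric]) auto
    also have "\<dots> = emeasure M (\<Union>i. F i) + emeasure N (\<Union>i. F i)"
      using F assms(1) by (simp add: suminf_emeasure)
    finally show "(\<Sum>i. emeasure M (F i) + emeasure N (F i)) = emeasure M (\<Union>i. F i) + emeasure N (\<Union>i. F i)" .
  qed
qed

definition cone_of_measures :: "'a measure set \<Rightarrow> bool" where
  "cone_of_measures K \<longleftrightarrow>
     (\<forall>M\<in>K. \<forall>N\<in>K. add_measure M N \<in> K) \<and>
     (\<forall>M\<in>K. \<forall>a::real. a > 0 \<longrightarrow> scale_measure (ennreal a) M \<in> K)"

(* Intended for finite sets of Borel measures that are finite on bounded Borel sets, as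
   doubling measures are; there the real-valued measure M A is the true measure of A. *)
definition independent_measures :: "'a::metric_space measure set \<Rightarrow> bool" where
  "independent_measures F \<longleftrightarrow>
     (\<forall>c :: 'a measure \<Rightarrow> real.
        (\<forall>A \<in> sets borel. bounded A \<longrightarrow> (\<Sum>M\<in>F. c M * measure M A) = 0) \<longrightarrow> (\<forall>M\<in>F. c M = 0))"

definition infinite_dimensional_cone :: "'a::metric_space measure set \<Rightarrow> bool" where
  "infinite_dimensional_cone K \<longleftrightarrow>
     cone_of_measures K \<and>
     (\<exists>S \<subseteq> K. infinite S \<and> (\<forall>F \<subseteq> S. finite F \<longrightarrow> independent_measures F))"

end

theory Submission
  imports Defs
begin

text \<open>
  The least doubling constant of Euclidean \<open>n\<close>-space is \<open>2^n\<close>, the constant of Lebesgue measure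
  (\<open>doubling_constant_ge\<close>): the average mass of balls of radius \<open>\<rho>\<close> with centres in \<open>B(0, 1)\<close> is at most a
  constant times \<open>\<rho>^n\<close>, so the mass of a ball cannot shrink more slowly than that everywhere. Hence \<open>\<mu>\<close> is a
  minimizer exactly if \<open>\<mu>(B(x, 2r)) \<le> 2^n \<mu>(B(x, r))\<close> for all \<open>x\<close> and \<open>r\<close>, that is, if its averages over
  balls do not increase when the radius is doubled. This is a weak form of superharmonicity, and the dichotomy
  between dimensions is that of potential theory: nonconstant positive superharmonic functions on the whole
  space exist precisely from dimension \<open>3\<close> on.

  In dimension at most \<open>2\<close>, integrating the translates of a continuous \<open>\<phi> \<ge> 0\<close> of compact support
  against a minimizer gives a continuous \<open>u \<ge> 0\<close> that is at least its own average over every ball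
  (\<open>mollification_super_mean\<close>). Comparison with the negative of a smoothed \<open>log (log |x|)\<close> shows that \<open>u\<close> is
  constant (\<open>super_mean_constant\<close>). So the minimizer is translation invariant and hence a multiple of Lebesgue
  measure (\<open>translation_invariant_eq_lborel\<close>).

  In dimension at least \<open>3\<close>, every positive superharmonic \<open>C^2\<close> function is the density of a minimizer
  (\<open>superharmonic_density_doubling_minimizer\<close>), and the functions \<open>(1 + |x|^2)^(-a)\<close> with \<open>0 < a \<le> 1/2\<close>
  are such densities. They are linearly independent because they decay at different rates.

  Both dimension ranges rest on one formula, \<open>unit_ball_integral_has_derivative\<close>: the derivative in \<open>r\<close> of the average
  over \<open>B(p, r)\<close> of a \<open>C^2\<close> function is an integral of its Laplacian against a positive weight.
\<close>

section \<open>Masses of balls under a doubling measure\<close>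

lemma sets_doubling_measure: "doubling_measure M \<Longrightarrow> sets M = sets borel"
  by (simp add: doubling_measure_def)

text \<open>
  Every ball is contained in some \<open>B(x0, 2^k r0)\<close>, whose mass is bounded by iterating the doubling inequality
  from the one ball \<open>B(x0, r0)\<close> known to have finite mass.
\<close>
lemma doubling_measure_ball_finite:
  fixes M :: "'a::metric_space measure"
  assumes "doubling_measure M"
  shows "emeasure M (ball x r) < \<infinity>"
proof -
  from assms obtain C x0 r0 where sets: "sets M = sets borel" and "C > 0"
    and dbl: "\<And>x r. r > 0 \<Longrightarrow> emeasure M (ball x (2 * r)) \<le> ennreal C * emeasure M (ball x r)"
    and r0: "r0 > 0" "emeasure M (ball x0 r0) < \<infinity>"
    unfolding doubling_measure_def by blast
  have fin: "emeasure M (ball x0 (2 ^ k * r0)) < \<infinity>" for k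
  proof (induction k)
    case (Suc k)
    have "emeasure M (ball x0 (2 ^ Suc k * r0)) \<le> ennreal C * emeasure M (ball x0 (2 ^ k * r0))"
      using dbl[of "2 ^ k * r0" x0] r0 by (simp add: mult.assoc)
    also have "\<dots> < \<infinity>"
      using Suc by (simp add: ennreal_mult_less_top)
    finally show ?case .
  qed (use r0 in simp)
  obtain k where k: "(dist x0 x + r) / r0 < 2 ^ k"
    using real_arch_pow[of 2] by auto
  have "ball x r \<subseteq> ball x0 (2 ^ k * r0)"
  proof
    fix y assume "y \<in> ball x r"
    hence "dist x0 y < dist x0 x + r"
      using dist_triangle[of x0 y x] by simp
    also have "\<dots> \<le> 2 ^ k * r0"
      using k r0(1) by (simp add: field_simps)
    finally show "y \<in> ball x0 (2 ^ k * r0)" by simp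
  qed
  hence "emeasure M (ball x r) \<le> emeasure M (ball x0 (2 ^ k * r0))"
    using sets by (intro emeasure_mono) auto
  thus ?thesis
    using fin[of k] by (rule le_less_trans)
qed

text \<open>
  If \<open>B(x, r)\<close> were null, so would be every \<open>B(x, 2^k r)\<close>, and one of them contains the ball known to have
  positive mass.
\<close>
lemma doubling_measure_ball_pos:
  fixes M :: "'a::metric_space measure"
  assumes "doubling_measure M" "r > 0"
  shows "0 < emeasure M (ball x r)"
proof (rule ccontr)
  assume "\<not> 0 < emeasure M (ball x r)"
  hence zero: "emeasure M (ball x r) = 0" by simp
  from assms obtain C x0 r0 where sets: "sets M = sets borel" and "C > 0"
    and dbl: "\<And>x r. r > 0 \<Longrightarrow> emeasure M (ball x (2 * r)) \<le> ennreal C * emeasure M (ball x r)"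
    and r0: "r0 > 0" "0 < emeasure M (ball x0 r0)"
    unfolding doubling_measure_def by blast
  have zero': "emeasure M (ball x (2 ^ k * r)) = 0" for k
  proof (induction k)
    case (Suc k)
    have "emeasure M (ball x (2 ^ Suc k * r)) \<le> ennreal C * emeasure M (ball x (2 ^ k * r))"
      using dbl[of "2 ^ k * r" x] assms(2) by (simp add: mult.assoc)
    with Suc show ?case by simp
  qed (use zero in simp)
  obtain k where k: "(dist x x0 + r0) / r < 2 ^ k"
    using real_arch_pow[of 2] by auto
  have "ball x0 r0 \<subseteq> ball x (2 ^ k * r)"
  proof
    fix y assume "y \<in> ball x0 r0"
    hence "dist x y < dist x x0 + r0"
      using dist_triangle[of x y x0] by simp
    also have "\<dots> \<le> 2 ^ k * r"
      using k assms(2) by (simp add: field_simps)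
    finally show "y \<in> ball x (2 ^ k * r)" by simp
  qed
  hence "emeasure M (ball x0 r0) \<le> emeasure M (ball x (2 ^ k * r))"
    using sets by (intro emeasure_mono) auto
  thus False
    using zero'[of k] r0(2) by simp
qed

lemma sigma_finite_doubling_measure:
  fixes M :: "'a::metric_space measure"
  assumes "doubling_measure M"
  shows "sigma_finite_measure M"
proof
  note [simp] = sets_doubling_measure[OF assms]
  have space: "space M = UNIV"
    using sets_eq_imp_space_eq[of M borel] by simp
  let ?A = "range (\<lambda>n. ball (undefined :: 'a) (real n))"
  have "x \<in> \<Union>?A" for x
    using reals_Archimedean2[of "dist undefined x"] by auto
  thus "\<exists>A. countable A \<and> A \<subseteq> sets M \<and> \<Union>A = space M \<and> (\<forall>a\<in>A. emeasure M a \<noteq> \<infinity>)"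
    using doubling_measure_ball_finite[OF assms] space
    by (intro exI[of _ ?A]) (auto simp: less_top)
qed

lemma emeasure_ball_le_doubling_constant:
  fixes M :: "'a::metric_space measure"
  assumes "doubling_measure M" "r > 0"
  shows "emeasure M (ball x (2 * r)) \<le> doubling_constant M * emeasure M (ball x r)"
proof -
  let ?m = "emeasure M (ball x r)"
  have "emeasure M (ball x (2 * r)) / ?m \<le> doubling_constant M"
    unfolding doubling_constant_def using assms(2) by (intro SUP_upper2[of "(x, r)"]) auto
  hence "emeasure M (ball x (2 * r)) / ?m * ?m \<le> doubling_constant M * ?m"
    by (rule mult_right_mono) simp
  moreover have "emeasure M (ball x (2 * r)) / ?m * ?m = emeasure M (ball x (2 * r))"
    using doubling_measure_ball_pos[OF assms, of x] doubling_measure_ball_finite[OF assms(1), of x r]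
    by (subst ennreal_divide_times) (simp add: ennreal_mult_divide_eq)
  ultimately show ?thesis by simp
qed

lemma doubling_constant_leI:
  fixes M :: "'a::metric_space measure"
  assumes "doubling_measure M"
    and "\<And>x r. r > 0 \<Longrightarrow> emeasure M (ball x (2 * r)) \<le> C * emeasure M (ball x r)"
  shows "doubling_constant M \<le> C"
  unfolding doubling_constant_def
proof (rule SUP_least, clarsimp)
  fix x :: 'a and r :: real assume r: "r > 0"
  let ?m = "emeasure M (ball x r)"
  have "emeasure M (ball x (2 * r)) / ?m \<le> C * ?m / ?m"
    using assms(2)[OF r] by (rule divide_right_mono_ennreal)
  also have "\<dots> = C"
    using doubling_measure_ball_pos[OF assms(1) r, of x] doubling_measure_ball_finite[OF assms(1), of x r]
    by (simp add: ennreal_mult_divide_eq)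
  finally show "emeasure M (ball x (2 * r)) / ?m \<le> C" .
qed

section \<open>The least doubling constant of Euclidean space\<close>

lemma nn_integral_lborel_translate:
  fixes f :: "'a::euclidean_space \<Rightarrow> ennreal"
  assumes "f \<in> borel_measurable borel"
  shows "(\<integral>\<^sup>+x. f (c + x) \<partial>lborel) = (\<integral>\<^sup>+x. f x \<partial>lborel)"
proof -
  have "(\<integral>\<^sup>+x. f x \<partial>lborel) = (\<integral>\<^sup>+x. f x \<partial>(distr lborel borel ((+) c)))"
    by (simp add: lborel_distr_plus)
  also have "\<dots> = (\<integral>\<^sup>+x. f (c + x) \<partial>lborel)"
    using assms by (subst nn_integral_distr) auto
  finally show ?thesis by simp
qed

lemma nn_integral_lborel_affine:
  fixes f :: "'a::euclidean_space \<Rightarrow> ennreal"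
  assumes [measurable]: "f \<in> borel_measurable borel" and "r \<noteq> 0"
  shows "(\<integral>\<^sup>+x. f x \<partial>lborel) = ennreal (\<bar>r\<bar> ^ DIM('a)) * (\<integral>\<^sup>+x. f (c + r *\<^sub>R x) \<partial>lborel)"
proof -
  have "(\<integral>\<^sup>+x. f x \<partial>lborel)
      = (\<integral>\<^sup>+x. f x \<partial>(density (distr lborel borel (\<lambda>x. c + r *\<^sub>R x)) (\<lambda>_. \<bar>r\<bar> ^ DIM('a))))"
    using lborel_affine[OF assms(2), of c] by simp
  also have "\<dots> = ennreal (\<bar>r\<bar> ^ DIM('a)) * (\<integral>\<^sup>+x. f (c + r *\<^sub>R x) \<partial>lborel)"
    by (simp add: nn_integral_density nn_integral_distr nn_integral_cmult)
  finally show ?thesis .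
qed

lemma nn_integral_lborel_reflect:
  fixes f :: "'a::euclidean_space \<Rightarrow> ennreal"
  assumes "f \<in> borel_measurable borel"
  shows "(\<integral>\<^sup>+x. f (c - x) \<partial>lborel) = (\<integral>\<^sup>+x. f x \<partial>lborel)"
  using nn_integral_lborel_affine[OF assms, of "-1" c] by simp

lemma sets_borel_ball [measurable]: "ball (x::'a::metric_space) r \<in> sets borel"
  by simp

lemma measurable_emeasure_ball:
  fixes M :: "'a::euclidean_space measure"
  assumes "sigma_finite_measure M" and sets_M [measurable_cong]: "sets M = sets borel"
  shows "(\<lambda>w. emeasure M (ball (x + w) r)) \<in> borel_measurable borel"
proof -
  interpret M: sigma_finite_measure M by fact
  have "{p \<in> space (borel \<Otimes>\<^sub>M M). dist (x + fst p) (snd p :: 'a) < r} \<in> sets (borel \<Otimes>\<^sub>M M)"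
    by measurable
  from M.measurable_emeasure_Pair[OF this] show ?thesis
    using sets_eq_imp_space_eq[OF sets_M] by (simp add: space_pair_measure ball_def)
qed

text \<open>
  Tonelli applied to the pairs \<open>(y, z)\<close> with \<open>y\<close> in \<open>B(x, r)\<close>, in the coordinates \<open>w = z - y\<close>: integrating
  the mollification of a measure over a ball is the same as mollifying its ball function. Hence
  mollification inherits every inequality between the measures of concentric balls.
\<close>
lemma nn_integral_ball_mollified:
  fixes M :: "'a::euclidean_space measure" and \<phi> :: "'a \<Rightarrow> ennreal"
  assumes "sigma_finite_measure M" and sets_M [measurable_cong]: "sets M = sets borel"
    and \<phi> [measurable]: "\<phi> \<in> borel_measurable borel"
  shows "(\<integral>\<^sup>+y\<in>ball x r. (\<integral>\<^sup>+z. \<phi> (z - y) \<partial>M) \<partial>lborel)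
       = (\<integral>\<^sup>+w. \<phi> w * emeasure M (ball (x + w) r) \<partial>lborel)"
proof -
  interpret M: sigma_finite_measure M by fact
  interpret P: pair_sigma_finite lborel M ..
  interpret Q: pair_sigma_finite M "lborel :: 'a measure" ..
  let ?i = "\<lambda>y. indicator (ball x r) y :: ennreal"
  have space_M: "space M = UNIV"
    using sets_eq_imp_space_eq[OF sets_M] by simp
  have "(\<integral>\<^sup>+y\<in>ball x r. (\<integral>\<^sup>+z. \<phi> (z - y) \<partial>M) \<partial>lborel) = (\<integral>\<^sup>+y. \<integral>\<^sup>+z. \<phi> (z - y) * ?i y \<partial>M \<partial>lborel)"
    by (simp add: nn_integral_multc)
  also have "\<dots> = (\<integral>\<^sup>+z. \<integral>\<^sup>+y. \<phi> (z - y) * ?i y \<partial>lborel \<partial>M)"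
    by (rule Q.Fubini') measurable
  also have "\<dots> = (\<integral>\<^sup>+z. \<integral>\<^sup>+w. \<phi> w * ?i (z - w) \<partial>lborel \<partial>M)"
  proof (rule nn_integral_cong)
    fix z
    show "(\<integral>\<^sup>+y. \<phi> (z - y) * ?i y \<partial>lborel) = (\<integral>\<^sup>+w. \<phi> w * ?i (z - w) \<partial>lborel)"
      using nn_integral_lborel_reflect[of "\<lambda>w. \<phi> w * ?i (z - w)" z] by simp
  qed
  also have "\<dots> = (\<integral>\<^sup>+w. \<integral>\<^sup>+z. \<phi> w * ?i (z - w) \<partial>M \<partial>lborel)"
    by (rule P.Fubini') measurable
  also have "\<dots> = (\<integral>\<^sup>+w. \<phi> w * emeasure M (ball (x + w) r) \<partial>lborel)"
  proof (rule nn_integral_cong)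
    fix w
    have "(\<integral>\<^sup>+z. \<phi> w * ?i (z - w) \<partial>M) = \<phi> w * (\<integral>\<^sup>+z. ?i (z - w) \<partial>M)"
      by (rule nn_integral_cmult) measurable
    also have "(\<integral>\<^sup>+z. ?i (z - w) \<partial>M) = (\<integral>\<^sup>+z. indicator (ball (x + w) r) z \<partial>M)"
      by (intro nn_integral_cong) (auto simp: indicator_def dist_norm algebra_simps)
    also have "\<dots> = emeasure M (ball (x + w) r)"
      by (simp add: sets_M)
    finally show "(\<integral>\<^sup>+z. \<phi> w * ?i (z - w) \<partial>M) = \<phi> w * emeasure M (ball (x + w) r)" .
  qed
  finally show ?thesis .
qed

lemma not_AE_not_in_ball:
  fixes p :: "'a::euclidean_space"
  assumes "r > 0"
  shows "\<not> (AE y in lborel. y \<notin> ball p r)"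
proof
  assume "AE y in lborel. y \<notin> ball p r"
  hence "emeasure lborel (ball p r) = 0"
    by (subst (asm) AE_iff_measurable[OF _ refl]) (auto simp: ball_def)
  moreover have "emeasure lborel (ball p r) > 0"
    using assms by (simp add: emeasure_ball)
  ultimately show False
    by simp
qed

lemma continuous_AE_eq_0:
  fixes h :: "'a::euclidean_space \<Rightarrow> real"
  assumes U: "open U" "y \<in> U" and cont: "continuous_on U h"
    and AE: "AE y in lborel. y \<in> U \<longrightarrow> h y = 0"
  shows "h y = 0"
proof (rule ccontr)
  assume "h y \<noteq> 0"
  have "open (U \<inter> h -` (- {0}))"
    using continuous_open_preimage[OF cont U(1)] by auto
  moreover have "y \<in> U \<inter> h -` (- {0})"
    using U(2) \<open>h y \<noteq> 0\<close> by simp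
  ultimately obtain e where "e > 0" "ball y e \<subseteq> U \<inter> h -` (- {0})"
    by (meson openE)
  with AE have "AE z in lborel. z \<notin> ball y e"
    by (auto elim!: eventually_mono)
  thus False
    using not_AE_not_in_ball[OF \<open>e > 0\<close>] by blast
qed

lemma emeasure_lborel_ball_double:
  "r > 0 \<Longrightarrow> emeasure lborel (ball (x::'a::euclidean_space) (2 * r))
     = ennreal (2 ^ DIM('a)) * emeasure lborel (ball x r)"
  by (simp add: emeasure_ball power_mult_distrib mult_ac flip: ennreal_mult)

lemma doubling_measure_lborel: "doubling_measure (lborel :: 'a::euclidean_space measure)"
  unfolding doubling_measure_def
proof (intro conjI)
  show "\<exists>C::real. C > 0 \<and> (\<forall>(x::'a) r. r > 0 \<longrightarrow>
      emeasure lborel (ball x (2 * r)) \<le> ennreal C * emeasure lborel (ball x r))"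
    by (intro exI[of _ "2 ^ DIM('a)"]) (auto simp: emeasure_lborel_ball_double)
  show "\<exists>x0 r0. r0 > 0 \<and> 0 < emeasure lborel (ball (x0::'a) r0) \<and> emeasure lborel (ball x0 r0) < \<infinity>"
    by (intro exI[of _ 0] exI[of _ 1]) (simp add: emeasure_ball)
qed simp

text \<open>
  After exchanging the order of integration, \<open>M(B(w, 1)) \<le> M(B(0, 2))\<close> is integrated over \<open>w\<close> in
  \<open>B(0, \<rho>)\<close>, which brings out the factor \<open>\<rho>^n\<close>: up to a constant, balls of radius \<open>\<rho>\<close> are on average not
  heavier than for Lebesgue measure.
\<close>
lemma nn_integral_emeasure_ball_le:
  fixes M :: "'a::euclidean_space measure"
  assumes "sigma_finite_measure M" and sets_M [measurable_cong]: "sets M = sets borel" and "\<rho> \<le> 1"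
  shows "(\<integral>\<^sup>+y\<in>ball 0 1. emeasure M (ball y \<rho>) \<partial>lborel)
       \<le> emeasure lborel (ball (0::'a) \<rho>) * emeasure M (ball 0 2)"
proof -
  have "(\<integral>\<^sup>+y\<in>ball 0 1. emeasure M (ball y \<rho>) \<partial>lborel)
      = (\<integral>\<^sup>+y\<in>ball 0 1. (\<integral>\<^sup>+z. indicator (ball 0 \<rho>) (z - y) \<partial>M) \<partial>lborel)"
  proof (intro nn_integral_cong arg_cong2[where f = "(*)"] refl)
    fix y :: 'a
    have "emeasure M (ball y \<rho>) = (\<integral>\<^sup>+z. indicator (ball y \<rho>) z \<partial>M)"
      by (simp add: sets_M)
    also have "\<dots> = (\<integral>\<^sup>+z. indicator (ball 0 \<rho>) (z - y) \<partial>M)"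
      by (intro nn_integral_cong) (auto simp: indicator_def dist_norm norm_minus_commute)
    finally show "emeasure M (ball y \<rho>) = (\<integral>\<^sup>+z. indicator (ball 0 \<rho>) (z - y) \<partial>M)" .
  qed
  also have "\<dots> = (\<integral>\<^sup>+w. indicator (ball 0 \<rho>) w * emeasure M (ball (0 + w) 1) \<partial>lborel)"
    by (rule nn_integral_ball_mollified[OF assms(1,2)]) auto
  also have "\<dots> \<le> (\<integral>\<^sup>+w. emeasure M (ball 0 2) * indicator (ball (0::'a) \<rho>) w \<partial>lborel)"
  proof (intro nn_integral_mono)
    fix w :: 'a
    have "emeasure M (ball w 1) \<le> emeasure M (ball 0 2)" if "norm w < \<rho>"
    proof (rule emeasure_mono)
      show "ball w 1 \<subseteq> ball 0 2"
        using that assms(3) norm_triangle_ineq3[of _ w]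
        by (auto simp: dist_norm norm_minus_commute) (smt (verit) norm_minus_commute norm_triangle_sub)
    qed (simp add: sets_M)
    thus "indicator (ball 0 \<rho>) w * emeasure M (ball (0 + w) 1) \<le> emeasure M (ball 0 2) * indicator (ball (0::'a) \<rho>) w"
      by (auto simp: indicator_def)
  qed
  also have "\<dots> = emeasure lborel (ball (0::'a) \<rho>) * emeasure M (ball 0 2)"
    by (subst nn_integral_cmult) (auto simp: mult.commute)
  finally show ?thesis .
qed

text \<open>
  If the doubling constant \<open>c\<close> were below \<open>2^n\<close>, halving the radius \<open>k\<close> times would keep a share
  \<open>c^(-k)\<close> of the mass of each unit ball, whereas on average only a share of order \<open>2^(-n k)\<close> can
  survive. Letting \<open>k\<close> tend to infinity, almost every unit ball centred in \<open>B(0, 1)\<close> would be null.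
\<close>
lemma doubling_constant_ge:
  fixes M :: "'a::euclidean_space measure"
  assumes M: "doubling_measure M"
  shows "ennreal (2 ^ DIM('a)) \<le> doubling_constant M"
proof (rule ccontr)
  let ?n = "DIM('a)"
  assume "\<not> ?thesis"
  hence less: "doubling_constant M < ennreal (2 ^ ?n)" by simp
  then obtain c where c: "doubling_constant M = ennreal c" "c \<ge> 0"
    by (cases "doubling_constant M") auto
  with less have c2: "c < 2 ^ ?n"
    by (simp add: ennreal_less_iff)
  note fin = doubling_measure_ball_finite[OF M] and pos = doubling_measure_ball_pos[OF M]
  note sf = sigma_finite_doubling_measure[OF M] and sets_M [measurable_cong] = sets_doubling_measure[OF M]
  interpret M: sigma_finite_measure M by (rule sf)
  define I where "I = (\<integral>\<^sup>+y\<in>ball 0 1. emeasure M (ball (y::'a) 1) \<partial>lborel)"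
  have [measurable]: "(\<lambda>y. emeasure M (ball (y::'a) \<rho>)) \<in> borel_measurable borel" for \<rho>
    using measurable_emeasure_ball[OF sf sets_M, of 0 \<rho>] by simp
  have chain: "emeasure M (ball y 1) \<le> ennreal (c ^ k) * emeasure M (ball y (1 / 2 ^ k))" for y k
  proof (induction k)
    case (Suc k)
    have "emeasure M (ball y (1 / 2 ^ k)) \<le> ennreal c * emeasure M (ball y (1 / 2 ^ Suc k))"
      using emeasure_ball_le_doubling_constant[OF M, of "1 / 2 ^ Suc k" y] c by simp
    hence "ennreal (c ^ k) * emeasure M (ball y (1 / 2 ^ k))
        \<le> ennreal (c ^ k) * (ennreal c * emeasure M (ball y (1 / 2 ^ Suc k)))"
      by (rule mult_left_mono) simp
    also have "\<dots> = ennreal (c ^ Suc k) * emeasure M (ball y (1 / 2 ^ Suc k))"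
      using c(2) by (simp add: ennreal_mult mult_ac)
    finally show ?case using Suc by simp
  qed simp
  have ne: "emeasure M (ball y 1) \<noteq> 0" for y
    using pos[of 1 y] by simp
  obtain b where b: "emeasure M (ball (0::'a) 2) = ennreal b" "b \<ge> 0"
    using fin[of 0 2] by (cases "emeasure M (ball (0::'a) 2)") auto
  let ?v = "unit_ball_vol (real ?n)"
  have I_le: "I \<le> ennreal ((c / 2 ^ ?n) ^ k * (?v * b))" for k
  proof -
    have "I \<le> (\<integral>\<^sup>+y. ennreal (c ^ k) * (emeasure M (ball y (1 / 2 ^ k)) * indicator (ball (0::'a) 1) y) \<partial>lborel)"
      unfolding I_def using chain
      by (intro nn_integral_mono) (auto simp: mult.assoc[symmetric] intro!: mult_right_mono)
    also have "\<dots> = ennreal (c ^ k) * (\<integral>\<^sup>+y\<in>ball (0::'a) 1. emeasure M (ball y (1 / 2 ^ k)) \<partial>lborel)"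
      by (rule nn_integral_cmult) simp
    also have "\<dots> \<le> ennreal (c ^ k) * (emeasure lborel (ball (0::'a) (1 / 2 ^ k)) * emeasure M (ball (0::'a) 2))"
      by (intro mult_left_mono nn_integral_emeasure_ball_le sf sets_M) auto
    also have "\<dots> = ennreal (c ^ k * (?v * (1 / 2 ^ k) ^ ?n * b))"
      using c(2) b by (simp add: emeasure_ball flip: ennreal_mult)
    also have "c ^ k * (?v * (1 / 2 ^ k) ^ ?n * b) = (c / 2 ^ ?n) ^ k * (?v * b)"
      by (simp add: power_divide mult_ac flip: power_mult)
    finally show ?thesis .
  qed
  have "(\<lambda>k. (c / 2 ^ ?n) ^ k * (?v * b)) \<longlonglongrightarrow> 0 * (?v * b)"
    using c c2 by (intro tendsto_intros LIMSEQ_power_zero) auto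
  hence "(\<lambda>k. ennreal ((c / 2 ^ ?n) ^ k * (?v * b))) \<longlonglongrightarrow> ennreal 0"
    by (intro tendsto_ennrealI) simp
  hence "I \<le> 0"
    using I_le by (intro tendsto_lowerbound[where F = sequentially]) (auto intro: always_eventually)
  hence "AE y in lborel. emeasure M (ball (y::'a) 1) * indicator (ball 0 1) y = 0"
    unfolding I_def by (subst (asm) le_zero_eq, subst (asm) nn_integral_0_iff_AE) measurable
  hence "AE y in lborel. y \<notin> ball (0::'a) 1"
    by (rule eventually_mono) (auto simp: indicator_def ne split: if_splits)
  thus False
    using not_AE_not_in_ball[of 1 "0::'a"] by simp
qed

lemma least_doubling_constant_euclidean:
  "least_doubling_constant TYPE('a::euclidean_space) = ennreal (2 ^ DIM('a))"
  unfolding least_doubling_constant_def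
proof (rule antisym)
  show "(INF M\<in>{M :: 'a measure. doubling_measure M}. doubling_constant M) \<le> ennreal (2 ^ DIM('a))"
    by (rule INF_lower2[of lborel])
      (auto simp: doubling_measure_lborel emeasure_lborel_ball_double intro!: doubling_constant_leI)
qed (auto intro!: INF_greatest doubling_constant_ge)

text \<open>
  Since no measure has a constant below \<open>2^n\<close>, being a minimizer is a family of linear inequalities in the
  measure. This is why the minimizers form a cone.
\<close>
lemma doubling_minimizers_iff:
  fixes M :: "'a::euclidean_space measure"
  shows "M \<in> doubling_minimizers \<longleftrightarrow> doubling_measure M \<and>
    (\<forall>x r. r > 0 \<longrightarrow> emeasure M (ball x (2 * r)) \<le> ennreal (2 ^ DIM('a)) * emeasure M (ball x r))"
proof -
  have "doubling_constant M = ennreal (2 ^ DIM('a)) \<longleftrightarrow>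
      (\<forall>x r. r > 0 \<longrightarrow> emeasure M (ball x (2 * r)) \<le> ennreal (2 ^ DIM('a)) * emeasure M (ball x r))"
    if M: "doubling_measure M"
    using emeasure_ball_le_doubling_constant[OF M] doubling_constant_leI[OF M] doubling_constant_ge[OF M]
    by (metis antisym)
  thus ?thesis
    by (auto simp: doubling_minimizers_def least_doubling_constant_euclidean)
qed

lemma doubling_minimizersI:
  fixes M :: "'a::euclidean_space measure"
  assumes "sets M = sets borel"
    and "\<And>x r. r > 0 \<Longrightarrow> emeasure M (ball x (2 * r)) \<le> ennreal (2 ^ DIM('a)) * emeasure M (ball x r)"
    and "r0 > 0" "0 < emeasure M (ball x0 r0)" "emeasure M (ball x0 r0) < \<infinity>"
  shows "M \<in> doubling_minimizers"
proof -
  have "doubling_measure M"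
    unfolding doubling_measure_def
  proof (intro conjI)
    show "\<exists>C::real. C > 0 \<and>
        (\<forall>x r. r > 0 \<longrightarrow> emeasure M (ball x (2 * r)) \<le> ennreal C * emeasure M (ball x r))"
      using assms(2) by (intro exI[of _ "2 ^ DIM('a)"]) auto
  qed (use assms in auto)
  thus ?thesis
    using assms(2) by (simp add: doubling_minimizers_iff)
qed

lemma cone_of_measures_doubling_minimizers:
  "cone_of_measures (doubling_minimizers :: 'a::euclidean_space measure set)"
  unfolding cone_of_measures_def
proof (intro conjI ballI allI impI)
  fix M N :: "'a measure"
  assume MN: "M \<in> doubling_minimizers" "N \<in> doubling_minimizers"
  hence dbl: "doubling_measure M" "doubling_measure N"
    by (auto simp: doubling_minimizers_iff)
  note sets = sets_doubling_measure[OF dbl(1)] sets_doubling_measure[OF dbl(2)]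
  have eq: "emeasure (add_measure M N) (ball x r) = emeasure M (ball x r) + emeasure N (ball x r)" for x r
    by (rule emeasure_add_measure) (auto simp: sets)
  show "add_measure M N \<in> doubling_minimizers"
  proof (rule doubling_minimizersI[of _ 1 0])
    fix x :: 'a and r :: real assume "r > 0"
    thus "emeasure (add_measure M N) (ball x (2 * r)) \<le> ennreal (2 ^ DIM('a)) * emeasure (add_measure M N) (ball x r)"
      using MN by (auto simp: eq doubling_minimizers_iff distrib_left intro!: add_mono)
  next
    show "0 < emeasure (add_measure M N) (ball 0 1)"
      using doubling_measure_ball_pos[OF dbl(1), of 1 0] by (simp add: eq add_pos_nonneg)
  qed (use dbl doubling_measure_ball_finite in \<open>auto simp: eq sets\<close>)
next
  fix M :: "'a measure" and a :: real
  assume M: "M \<in> doubling_minimizers" and a: "a > 0"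
  hence dbl: "doubling_measure M"
    by (auto simp: doubling_minimizers_iff)
  show "scale_measure (ennreal a) M \<in> doubling_minimizers"
  proof (rule doubling_minimizersI[of _ 1 0])
    fix x :: 'a and r :: real assume "r > 0"
    thus "emeasure (scale_measure (ennreal a) M) (ball x (2 * r))
        \<le> ennreal (2 ^ DIM('a)) * emeasure (scale_measure (ennreal a) M) (ball x r)"
      using M by (auto simp: doubling_minimizers_iff mult.left_commute intro!: mult_left_mono)
  qed (use doubling_measure_ball_pos[OF dbl, of 1 0] doubling_measure_ball_finite[OF dbl, of 0 1] a
       sets_doubling_measure[OF dbl]
       in \<open>auto simp: ennreal_mult_less_top ennreal_zero_less_mult_iff\<close>)
qed

section \<open>Ball averages and the Laplacian\<close>

lemma has_real_derivative_integral:
  fixes \<phi> :: "real \<Rightarrow> 'b \<Rightarrow> real"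
  assumes "\<delta> > 0"
    and int: "\<And>t. \<bar>t - t0\<bar> < \<delta> \<Longrightarrow> integrable M (\<phi> t)"
    and K: "integrable M K"
    and bound: "\<And>t y. \<bar>t - t0\<bar> < \<delta> \<Longrightarrow> \<bar>\<phi> t y - \<phi> t0 y\<bar> \<le> K y * \<bar>t - t0\<bar>"
    and deriv: "AE y in M. ((\<lambda>t. \<phi> t y) has_real_derivative \<phi>' y) (at t0)"
    and meas [measurable]: "\<phi>' \<in> borel_measurable M"
  shows "((\<lambda>t. \<integral>y. \<phi> t y \<partial>M) has_real_derivative (\<integral>y. \<phi>' y \<partial>M)) (at t0)"
proof -
  have *: "(\<lambda>i. ((\<integral>y. \<phi> (X i) y \<partial>M) - (\<integral>y. \<phi> t0 y \<partial>M)) / (X i - t0)) \<longlonglongrightarrow> (\<integral>y. \<phi>' y \<partial>M)"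
    if X: "\<And>i. X i \<noteq> t0" "X \<longlonglongrightarrow> t0" "\<And>i. \<bar>X i - t0\<bar> < \<delta>" for X :: "nat \<Rightarrow> real"
  proof -
    let ?q = "\<lambda>i y. (\<phi> (X i) y - \<phi> t0 y) / (X i - t0)"
    have i0: "integrable M (\<phi> t0)" and iX: "integrable M (\<phi> (X i))" for i
      using int[of t0] int[OF X(3)] \<open>\<delta> > 0\<close> by auto
    have q_meas: "?q i \<in> borel_measurable M" for i
      using i0 iX[of i] by (intro borel_measurable_divide borel_measurable_diff borel_measurable_integrable) auto
    have lim: "AE y in M. (\<lambda>i. ?q i y) \<longlonglongrightarrow> \<phi>' y"
      using deriv
    proof eventually_elim
      case (elim y)
      hence "((\<lambda>t. (\<phi> t y - \<phi> t0 y) / (t - t0)) \<longlongrightarrow> \<phi>' y) (at t0)"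
        by (simp add: has_field_derivative_iff)
      thus ?case
        using X unfolding tendsto_at_iff_sequentially by (auto simp: o_def)
    qed
    have bd: "AE y in M. norm (?q i y) \<le> K y" for i
      using bound[OF X(3)] X(1)[of i] by (intro AE_I2) (simp add: abs_divide divide_le_eq)
    have "(\<lambda>i. \<integral>y. ?q i y \<partial>M) \<longlonglongrightarrow> (\<integral>y. \<phi>' y \<partial>M)"
      by (rule integral_dominated_convergence[OF meas q_meas K lim bd])
    thus ?thesis
      using i0 iX by simp
  qed
  show "((\<lambda>t. \<integral>y. \<phi> t y \<partial>M) has_real_derivative (\<integral>y. \<phi>' y \<partial>M)) (at t0)"
    unfolding has_field_derivative_iff tendsto_at_iff_sequentially o_def
  proof (intro allI impI)
    fix X :: "nat \<Rightarrow> real"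
    assume X: "\<forall>i. X i \<in> UNIV - {t0}" "X \<longlonglongrightarrow> t0"
    have "eventually (\<lambda>i. \<bar>X i - t0\<bar> < \<delta>) sequentially"
      using tendstoD[OF X(2) \<open>\<delta> > 0\<close>] by (simp add: dist_real_def)
    then obtain N where N: "\<And>i. i \<ge> N \<Longrightarrow> \<bar>X i - t0\<bar> < \<delta>"
      by (auto simp: eventually_sequentially)
    have "(\<lambda>i. ((\<integral>y. \<phi> (X (i + N)) y \<partial>M) - (\<integral>y. \<phi> t0 y \<partial>M)) / (X (i + N) - t0)) \<longlonglongrightarrow> (\<integral>y. \<phi>' y \<partial>M)"
      using *[of "\<lambda>i. X (i + N)"] X N LIMSEQ_ignore_initial_segment[OF X(2), of N] by auto
    thus "(\<lambda>i. ((\<integral>y. \<phi> (X i) y \<partial>M) - (\<integral>y. \<phi> t0 y \<partial>M)) / (X i - t0)) \<longlonglongrightarrow> (\<integral>y. \<phi>' y \<partial>M)"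
      by (rule LIMSEQ_offset)
  qed
qed

text \<open>
  The integral of \<open>g(y + t e)\<close> over the whole space does not depend on \<open>t\<close>, so its derivative at \<open>t = 0\<close>
  vanishes. Demanding the derivative only almost everywhere admits functions with a kink along a sphere.
\<close>
lemma integral_directional_derivative_eq_0:
  fixes g :: "'a::euclidean_space \<Rightarrow> real"
  assumes supp: "\<And>x. norm x \<ge> R \<Longrightarrow> g x = 0"
    and lip: "\<And>x y. \<bar>g x - g y\<bar> \<le> K * norm (x - y)"
    and deriv: "AE y in lborel. ((\<lambda>t. g (y + t *\<^sub>R e)) has_real_derivative g' y) (at 0)"
    and meas: "g' \<in> borel_measurable borel"
  shows "(\<integral>y. g' y \<partial>lborel) = 0"
proof -
  have cont: "continuous_on UNIV g"
  proof (rule continuous_onI)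
    fix x :: 'a and \<epsilon> :: real assume "\<epsilon> > 0"
    show "\<exists>d>0. \<forall>x'\<in>UNIV. dist x' x < d \<longrightarrow> dist (g x') (g x) \<le> \<epsilon>"
    proof (intro exI[of _ "\<epsilon> / (\<bar>K\<bar> + 1)"] conjI ballI impI)
      fix x' assume d: "dist x' x < \<epsilon> / (\<bar>K\<bar> + 1)"
      have "\<bar>g x' - g x\<bar> \<le> K * norm (x' - x)" by (rule lip)
      also have "\<dots> \<le> (\<bar>K\<bar> + 1) * norm (x' - x)" by (rule mult_right_mono) auto
      also have "\<dots> \<le> \<epsilon>" using d by (simp add: dist_norm field_simps)
      finally show "dist (g x') (g x) \<le> \<epsilon>" by (simp add: dist_real_def)
    qed (use \<open>\<epsilon> > 0\<close> in simp)
  qed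
  hence [measurable]: "g \<in> borel_measurable borel"
    by (rule borel_measurable_continuous_onI)
  have int: "integrable lborel g"
  proof (rule Bochner_Integration.integrable_bound)
    show "integrable lborel (\<lambda>x. indicator (cball 0 R) x *\<^sub>R g x)"
      by (rule borel_integrable_compact) (use cont continuous_on_subset in auto)
    show "AE x in lborel. norm (g x) \<le> norm (indicator (cball 0 R) x *\<^sub>R g x)"
      using supp by (intro AE_I2) (auto simp: indicator_def)
  qed simp
  have shift: "integrable lborel (\<lambda>y. g (y + t *\<^sub>R e))"
    "(\<integral>y. g (y + t *\<^sub>R e) \<partial>lborel) = (\<integral>y. g y \<partial>lborel)" for t
  proof -
    have "integrable (distr lborel borel ((+) (t *\<^sub>R e))) g"
      using int by (simp add: lborel_distr_plus)
    thus "integrable lborel (\<lambda>y. g (y + t *\<^sub>R e))"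
      by (subst (asm) integrable_distr_eq) (auto simp: add.commute)
    have "(\<integral>y. g y \<partial>lborel) = (\<integral>y. g y \<partial>(distr lborel borel ((+) (t *\<^sub>R e))))"
      by (simp add: lborel_distr_plus)
    also have "\<dots> = (\<integral>y. g (y + t *\<^sub>R e) \<partial>lborel)"
      by (subst integral_distr) (auto simp: add.commute)
    finally show "(\<integral>y. g (y + t *\<^sub>R e) \<partial>lborel) = (\<integral>y. g y \<partial>lborel)" ..
  qed
  define D where "D = (\<lambda>y::'a. \<bar>K\<bar> * norm e * indicator (cball 0 (R + norm e)) y)"
  have D_int: "integrable lborel D"
    unfolding D_def by (intro integrable_mult_right integrable_real_indicator)
      (auto simp: emeasure_lborel_cball_finite[unfolded infinity_ennreal_def])
  have bound: "\<bar>g (y + t *\<^sub>R e) - g (y + 0 *\<^sub>R e)\<bar> \<le> D y * \<bar>t - 0\<bar>" if "\<bar>t - 0\<bar> < 1" for t y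
  proof (cases "norm y \<le> R + norm e")
    case True
    have "\<bar>g (y + t *\<^sub>R e) - g (y + 0 *\<^sub>R e)\<bar> \<le> K * norm (t *\<^sub>R e)"
      using lip[of "y + t *\<^sub>R e" y] by simp
    also have "\<dots> \<le> \<bar>K\<bar> * norm (t *\<^sub>R e)" by (rule mult_right_mono) auto
    finally show ?thesis using True by (simp add: D_def mult_ac)
  next
    case False
    have "\<bar>t\<bar> * norm e \<le> norm e" using that by (simp add: mult_left_le_one_le)
    hence "norm (y + t *\<^sub>R e) \<ge> R"
      using norm_triangle_ineq2[of y "- (t *\<^sub>R e)"] False by simp
    moreover have "norm y \<ge> R" using False norm_ge_zero[of e] by linarith
    ultimately show ?thesis using supp False by (simp add: D_def)
  qed
  have meas': "g' \<in> borel_measurable lborel" using meas by simp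
  have "((\<lambda>t. \<integral>y. g (y + t *\<^sub>R e) \<partial>lborel) has_real_derivative (\<integral>y. g' y \<partial>lborel)) (at 0)"
    by (rule has_real_derivative_integral[where \<phi> = "\<lambda>t y. g (y + t *\<^sub>R e)", OF zero_less_one _ D_int bound deriv meas'])
       (auto simp: shift)
  hence "((\<lambda>t. \<integral>y. g y \<partial>lborel) has_real_derivative (\<integral>y. g' y \<partial>lborel)) (at (0::real))"
    by (simp add: shift)
  from DERIV_unique[OF this DERIV_const] show "(\<integral>y. g' y \<partial>lborel) = 0" .
qed

lemma lipschitz_on_ball_of_continuous_gradient:
  fixes f :: "'a::euclidean_space \<Rightarrow> real"
  assumes "\<And>x. (f has_derivative (\<lambda>h. g x \<bullet> h)) (at x)" and "continuous_on UNIV g"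
  obtains K where "K \<ge> 0" "\<And>x y. x \<in> cball p R \<Longrightarrow> y \<in> cball p R \<Longrightarrow> \<bar>f x - f y\<bar> \<le> K * norm (x - y)"
proof -
  have "compact (g ` cball p R)"
    using assms(2) by (intro compact_continuous_image) (auto intro: continuous_on_subset)
  then obtain B where "B > 0" and "\<forall>y\<in>g ` cball p R. norm y \<le> B"
    using compact_imp_bounded[of "g ` cball p R"] unfolding bounded_pos by blast
  hence B: "B > 0" "\<And>x. x \<in> cball p R \<Longrightarrow> norm (g x) \<le> B"
    by blast+
  have "norm (f x - f y) \<le> B * norm (x - y)" if "x \<in> cball p R" "y \<in> cball p R" for x y
  proof (rule differentiable_bound[OF convex_cball _ _ that])
    show "(f has_derivative (\<lambda>h. g x \<bullet> h)) (at x within cball p R)" for x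
      using assms(1) by (rule has_derivative_at_withinI)
    show "onorm (\<lambda>h. g x \<bullet> h) \<le> B" if "x \<in> cball p R" for x
    proof (rule onorm_le)
      fix h
      have "norm (g x \<bullet> h) \<le> norm (g x) * norm h" by (rule Cauchy_Schwarz_ineq2[folded real_norm_def])
      also have "\<dots> \<le> B * norm h" using B(2)[OF that] by (rule mult_right_mono) simp
      finally show "norm (g x \<bullet> h) \<le> B * norm h" .
    qed
  qed
  with B(1) show ?thesis by (intro that[of B]) auto
qed

lemma integrable_indicator_ball_continuous_on:
  fixes h :: "'a::euclidean_space \<Rightarrow> real"
  assumes "continuous_on UNIV h"
  shows "integrable lborel (\<lambda>y. indicator (ball p s) y * h y)"
proof (rule Bochner_Integration.integrable_bound)
  show "integrable lborel (\<lambda>x. indicator (cball p s) x *\<^sub>R h x)"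
    by (rule borel_integrable_compact) (use assms continuous_on_subset in auto)
  show "(\<lambda>y. indicator (ball p s) y * h y) \<in> borel_measurable lborel"
    using borel_measurable_continuous_onI[OF assms] by measurable
qed (auto simp: indicator_def)

lemma DERIV_along_line:
  fixes u :: "'a::euclidean_space \<Rightarrow> real"
  assumes "\<And>x. (u has_derivative (\<lambda>h. v x \<bullet> h)) (at x)"
  shows "((\<lambda>t. u (x + t *\<^sub>R e)) has_real_derivative v (x + t *\<^sub>R e) \<bullet> e) (at t)"
proof -
  have "((\<lambda>t. x + t *\<^sub>R e) has_derivative (\<lambda>s. s *\<^sub>R e)) (at t)"
    by (auto intro!: derivative_eq_intros)
  from diff_chain_at[OF this assms]
  have "(u \<circ> (\<lambda>t. x + t *\<^sub>R e) has_derivative (\<lambda>h. v (x + t *\<^sub>R e) \<bullet> h) \<circ> (\<lambda>s. s *\<^sub>R e)) (at t)" .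
  thus ?thesis
    by (simp add: has_field_derivative_def o_def mult.commute[of _ "v _ \<bullet> e"])
qed

text \<open>
  A twice continuously differentiable function with its gradient field and the rows \<open>hess i\<close> of its Hessian
  as parameters, so that applications supply closed formulas for them.
\<close>
locale C2_function =
  fixes f :: "'a::euclidean_space \<Rightarrow> real" and grad :: "'a \<Rightarrow> 'a" and hess :: "'a \<Rightarrow> 'a \<Rightarrow> 'a"
  assumes has_gradient: "(f has_derivative (\<lambda>h. grad x \<bullet> h)) (at x)"
    and has_hessian: "i \<in> Basis \<Longrightarrow> ((\<lambda>x. grad x \<bullet> i) has_derivative (\<lambda>h. hess i x \<bullet> h)) (at x)"
    and continuous_hessian: "i \<in> Basis \<Longrightarrow> continuous_on UNIV (hess i)"
begin

definition laplacian :: "'a \<Rightarrow> real" where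
  "laplacian x = (\<Sum>i\<in>Basis. hess i x \<bullet> i)"

text \<open>The average of \<open>f\<close> over \<open>B(p, r)\<close>, times the volume of the unit ball, extended to \<open>r = 0\<close> by continuity.\<close>
definition unit_ball_integral :: "'a \<Rightarrow> real \<Rightarrow> real" where
  "unit_ball_integral p r = (\<integral>y. indicator (ball 0 1) y * f (p + r *\<^sub>R y) \<partial>lborel)"

lemma continuous_f: "continuous_on S f"
  using has_gradient by (meson continuous_at_imp_continuous_on has_derivative_continuous)

lemma continuous_grad: "continuous_on S grad"
proof -
  have "continuous_on S (\<lambda>x. grad x \<bullet> i)" if "i \<in> Basis" for i
    using has_hessian[OF that] by (meson continuous_at_imp_continuous_on has_derivative_continuous)
  thus ?thesis
    by (subst continuous_on_componentwise) auto
qed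

lemma continuous_laplacian: "continuous_on S laplacian"
  unfolding laplacian_def
  by (intro continuous_intros continuous_on_subset[OF continuous_hessian]) auto

lemma measurable_C2 [measurable]:
  "f \<in> borel_measurable borel" "grad \<in> borel_measurable borel" "laplacian \<in> borel_measurable borel"
  "i \<in> Basis \<Longrightarrow> hess i \<in> borel_measurable borel"
  by (intro borel_measurable_continuous_onI continuous_f continuous_grad continuous_laplacian
        continuous_hessian; simp)+

text \<open>
  Integration by parts without boundary term: \<open>y\<close> is minus the gradient of \<open>w(y) = (1 - |y|^2) / 2\<close>, and
  \<open>w\<close> vanishes on the unit sphere. Cut off at \<open>0\<close>, \<open>w\<close> is Lipschitz on the whole space, so the total
  integral of each \<open>\<partial>_i (w \<cdot> \<partial>_i f(p + r y))\<close> is zero; the sum over \<open>i\<close> is the claim.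
\<close>
lemma integral_grad_inner_eq_laplacian:
  "(\<integral>y. indicator (ball 0 1) y * (grad (p + r *\<^sub>R y) \<bullet> y) \<partial>lborel)
     = r * (\<integral>y. indicator (ball 0 1) y * ((1 - (norm y)\<^sup>2) / 2 * laplacian (p + r *\<^sub>R y)) \<partial>lborel)"
proof -
  define w where "w = (\<lambda>y::'a. max 0 ((1 - (norm y)\<^sup>2) / 2))"
  let ?I = "\<lambda>y. indicator (ball (0::'a) 1) y :: real"
  have w_out: "w y = 0" if "norm y \<ge> 1" for y
    using one_le_power[OF that, of 2] by (simp add: w_def)
  have w_01: "\<bar>w y\<bar> \<le> 1" for y
  proof -
    have "- 1 \<le> (norm y)\<^sup>2" by (rule order_trans[of _ 0]) auto
    thus ?thesis by (simp add: w_def)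
  qed
  \<comment> \<open>On the unit ball \<open>w\<close> has slope at most \<open>1\<close>, and it is \<open>0\<close> outside.\<close>
  have w_lip: "\<bar>w x - w y\<bar> \<le> norm (x - y)" if "norm x \<le> 1" for x y :: 'a
  proof (cases "norm y \<le> 1")
    case True
    have "\<bar>(norm y)\<^sup>2 - (norm x)\<^sup>2\<bar> = \<bar>norm y - norm x\<bar> * \<bar>norm y + norm x\<bar>"
      unfolding abs_mult[symmetric] by (simp add: power2_eq_square algebra_simps)
    also have "\<dots> \<le> norm (x - y) * 2"
      using True that norm_triangle_ineq3[of y x] by (intro mult_mono) (auto simp: norm_minus_commute)
    finally show ?thesis
      using True that by (simp add: w_def power_le_one abs_le_iff max_def) (simp add: field_simps)
  next
    case False
    have "0 \<le> w x" by (simp add: w_def)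
    moreover have "w x \<le> 1 - norm x"
    proof -
      have "(1 - (norm x)\<^sup>2) / 2 = (1 - norm x) * ((1 + norm x) / 2)"
        by (simp add: power2_eq_square field_simps)
      also have "\<dots> \<le> (1 - norm x) * 1"
        using that by (intro mult_left_mono) auto
      finally show ?thesis using that by (simp add: w_def)
    qed
    moreover have "w y = 0"
      using False by (simp add: w_out)
    moreover have "norm y - norm x \<le> norm (x - y)"
      using norm_triangle_ineq2[of y x] by (simp add: norm_minus_commute)
    ultimately show ?thesis using False by simp
  qed
  have part: "(\<integral>y. ?I y * ((y \<bullet> i) * (grad (p + r *\<^sub>R y) \<bullet> i)) \<partial>lborel)
      = r * (\<integral>y. ?I y * ((1 - (norm y)\<^sup>2) / 2 * (hess i (p + r *\<^sub>R y) \<bullet> i)) \<partial>lborel)"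
    if i: "i \<in> Basis" for i
  proof -
    define V where "V = (\<lambda>y. grad (p + r *\<^sub>R y) \<bullet> i)"
    have V_deriv: "(V has_derivative (\<lambda>h. (r *\<^sub>R hess i (p + r *\<^sub>R y)) \<bullet> h)) (at y)" for y
    proof -
      have "((\<lambda>y. p + r *\<^sub>R y) has_derivative (\<lambda>h. r *\<^sub>R h)) (at y)"
        by (auto intro!: derivative_eq_intros)
      from diff_chain_at[OF this has_hessian[OF i]] show ?thesis
        by (simp add: V_def o_def)
    qed
    have V_cont: "continuous_on UNIV (\<lambda>y. r *\<^sub>R hess i (p + r *\<^sub>R y))"
      by (intro continuous_intros continuous_on_compose2[OF continuous_hessian[OF i]]) auto
    obtain K where K: "K \<ge> 0" "\<And>x y. norm x \<le> 1 \<Longrightarrow> norm y \<le> 1 \<Longrightarrow> \<bar>V x - V y\<bar> \<le> K * norm (x - y)"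
      using lipschitz_on_ball_of_continuous_gradient[OF V_deriv V_cont, of 0 1] by auto
    have V_bound: "\<bar>V x\<bar> \<le> \<bar>V 0\<bar> + K" if "norm x \<le> 1" for x
    proof -
      have "\<bar>V x - V 0\<bar> \<le> K * 1"
        using K(2)[of x 0] K(1) that mult_left_mono[OF that K(1)] by simp
      thus ?thesis by simp
    qed
    let ?L = "\<bar>V 0\<bar> + K + K"
    let ?g = "\<lambda>y. w y * V y"
    have lip1: "\<bar>?g x - ?g y\<bar> \<le> ?L * norm (x - y)" if x: "norm x \<le> 1" for x y
    proof (cases "norm y \<le> 1")
      case True
      have "\<bar>?g x - ?g y\<bar> = \<bar>(w x - w y) * V x + w y * (V x - V y)\<bar>"
        by (simp add: algebra_simps)
      also have "\<dots> \<le> \<bar>w x - w y\<bar> * \<bar>V x\<bar> + \<bar>w y\<bar> * \<bar>V x - V y\<bar>"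
        by (metis abs_mult abs_triangle_ineq)
      also have "\<dots> \<le> norm (x - y) * (\<bar>V 0\<bar> + K) + 1 * (K * norm (x - y))"
        using w_lip[OF x, of y] V_bound[OF x] K(1) K(2)[OF x True]
        by (intro add_mono mult_mono) (auto simp: w_01)
      finally show ?thesis by (simp add: algebra_simps)
    next
      case False
      hence "w y = 0"
        by (simp add: w_out)
      hence "\<bar>?g x - ?g y\<bar> = \<bar>w x - w y\<bar> * \<bar>V x\<bar>" by (simp add: abs_mult)
      also have "\<dots> \<le> norm (x - y) * ?L"
        using w_lip[OF x, of y] V_bound[OF x] K(1) by (intro mult_mono) auto
      finally show ?thesis by (simp add: mult.commute)
    qed
    have lip: "\<bar>?g x - ?g y\<bar> \<le> ?L * norm (x - y)" for x y
    proof -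
      consider "norm x \<le> 1" | "norm y \<le> 1" | "norm x \<ge> 1" "norm y \<ge> 1" by linarith
      thus ?thesis
      proof cases
        case 3
        thus ?thesis using K(1) by (simp add: w_out)
      qed (use lip1[of x y] lip1[of y x] in \<open>auto simp: norm_minus_commute abs_minus_commute\<close>)
    qed
    define D where "D = (\<lambda>y. ?I y * ((1 - (norm y)\<^sup>2) / 2 * (r * (hess i (p + r *\<^sub>R y) \<bullet> i)) - (y \<bullet> i) * V y))"
    \<comment> \<open>The cut-off \<open>w\<close> has a kink on the unit sphere, which is a null set.\<close>
    have D_deriv: "((\<lambda>t. ?g (y + t *\<^sub>R i)) has_real_derivative D y) (at 0)" if "norm y \<noteq> 1" for y
    proof (cases "norm y < 1")
      case True
      have "eventually (\<lambda>t. y + t *\<^sub>R i \<in> ball 0 1) (nhds (0::real))"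
      proof -
        have "((\<lambda>t. y + t *\<^sub>R i) \<longlongrightarrow> y + 0 *\<^sub>R i) (nhds 0)"
          by (intro tendsto_intros filterlim_ident)
        thus ?thesis
          using True by (intro topological_tendstoD) auto
      qed
      hence ev: "eventually (\<lambda>t. ((1 - (y + t *\<^sub>R i) \<bullet> (y + t *\<^sub>R i)) / 2) * V (y + t *\<^sub>R i) = ?g (y + t *\<^sub>R i)) (nhds 0)"
        by eventually_elim (auto simp: w_def power2_norm_eq_inner[symmetric] power_le_one)
      have "((\<lambda>t. V (y + t *\<^sub>R i)) has_real_derivative (r *\<^sub>R hess i (p + r *\<^sub>R (y + 0 *\<^sub>R i))) \<bullet> i) (at 0)"
        by (rule DERIV_along_line[OF V_deriv])
      hence dV: "((\<lambda>t. V (y + t *\<^sub>R i)) has_real_derivative r * (hess i (p + r *\<^sub>R y) \<bullet> i)) (at 0)"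
        by simp
      have dw: "((\<lambda>t. (1 - (y + t *\<^sub>R i) \<bullet> (y + t *\<^sub>R i)) / 2) has_real_derivative - (y \<bullet> i)) (at 0)"
      proof -
        have eq: "(\<lambda>t. (1 - (y + t *\<^sub>R i) \<bullet> (y + t *\<^sub>R i)) / 2) = (\<lambda>t. (1 - (y \<bullet> y + 2 * t * (y \<bullet> i) + t * t)) / 2)"
          using i by (simp add: inner_add_left inner_add_right inner_commute algebra_simps)
        show ?thesis unfolding eq by (auto intro!: derivative_eq_intros)
      qed
      have "((\<lambda>t. ((1 - (y + t *\<^sub>R i) \<bullet> (y + t *\<^sub>R i)) / 2) * V (y + t *\<^sub>R i)) has_real_derivative D y) (at 0)"
        using DERIV_mult[OF dw dV] True
        by (simp add: D_def power2_norm_eq_inner algebra_simps)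
      thus ?thesis
        using DERIV_cong_ev[OF refl ev refl] by simp
    next
      case False
      with that have out: "norm y > 1" by simp
      have "eventually (\<lambda>t. y + t *\<^sub>R i \<in> - cball 0 1) (nhds (0::real))"
      proof -
        have "((\<lambda>t. y + t *\<^sub>R i) \<longlongrightarrow> y + 0 *\<^sub>R i) (nhds 0)"
          by (intro tendsto_intros filterlim_ident)
        thus ?thesis
          using out by (intro topological_tendstoD) (auto simp: open_Compl)
      qed
      hence ev: "eventually (\<lambda>t. 0 = ?g (y + t *\<^sub>R i)) (nhds 0)"
        by eventually_elim (auto simp: w_out)
      have "D y = 0" using out by (simp add: D_def)
      thus ?thesis
        using DERIV_cong_ev[OF refl ev refl, of "D y"] by simp
    qed
    have null: "sphere (0::'a) 1 \<in> null_sets lborel"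
      using negligible_sphere[of "0::'a" 1]
      by (auto simp: null_sets_completion_iff negligible_iff_null_sets)
    have AE_D: "AE y in lborel. ((\<lambda>t. ?g (y + t *\<^sub>R i)) has_real_derivative D y) (at 0)"
      using AE_not_in[OF null] by eventually_elim (auto intro: D_deriv)
    have D_meas: "D \<in> borel_measurable borel"
      unfolding D_def V_def using i by measurable
    have "(\<integral>y. D y \<partial>lborel) = 0"
      by (rule integral_directional_derivative_eq_0[OF _ lip AE_D D_meas, of 1]) (auto simp: w_out)
    have int1: "integrable lborel (\<lambda>y. ?I y * ((1 - (norm y)\<^sup>2) / 2 * (hess i (p + r *\<^sub>R y) \<bullet> i)))"
      by (intro integrable_indicator_ball_continuous_on continuous_intros
          continuous_on_compose2[OF continuous_hessian[OF i]]) auto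
    have int2: "integrable lborel (\<lambda>y. ?I y * ((y \<bullet> i) * V y))"
      unfolding V_def
      by (intro integrable_indicator_ball_continuous_on continuous_intros
          continuous_on_compose2[OF continuous_grad]) auto
    have "D = (\<lambda>y. r * (?I y * ((1 - (norm y)\<^sup>2) / 2 * (hess i (p + r *\<^sub>R y) \<bullet> i))) - ?I y * ((y \<bullet> i) * V y))"
      by (simp add: D_def fun_eq_iff algebra_simps)
    hence "(\<integral>y. D y \<partial>lborel) = (\<integral>y. r * (?I y * ((1 - (norm y)\<^sup>2) / 2 * (hess i (p + r *\<^sub>R y) \<bullet> i)))
        - ?I y * ((y \<bullet> i) * V y) \<partial>lborel)"
      by (rule arg_cong)
    moreover have "(\<integral>y. r * (?I y * ((1 - (norm y)\<^sup>2) / 2 * (hess i (p + r *\<^sub>R y) \<bullet> i)))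
        - ?I y * ((y \<bullet> i) * V y) \<partial>lborel)
      = (\<integral>y. r * (?I y * ((1 - (norm y)\<^sup>2) / 2 * (hess i (p + r *\<^sub>R y) \<bullet> i))) \<partial>lborel)
        - (\<integral>y. ?I y * ((y \<bullet> i) * V y) \<partial>lborel)"
      by (rule Bochner_Integration.integral_diff[OF integrable_mult_right[OF int1] int2])
    moreover have "(\<integral>y. r * (?I y * ((1 - (norm y)\<^sup>2) / 2 * (hess i (p + r *\<^sub>R y) \<bullet> i))) \<partial>lborel)
        = r * (\<integral>y. ?I y * ((1 - (norm y)\<^sup>2) / 2 * (hess i (p + r *\<^sub>R y) \<bullet> i)) \<partial>lborel)"
      by (rule integral_mult_right_zero)
    ultimately show ?thesis
      using \<open>(\<integral>y. D y \<partial>lborel) = 0\<close> unfolding V_def by linarith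
  qed
  have inner_swap: "x \<bullet> y = (\<Sum>i\<in>Basis. (y \<bullet> i) * (x \<bullet> i))" for x y :: 'a
    by (subst euclidean_inner) (intro sum.cong refl mult.commute)
  have "(\<integral>y. ?I y * (grad (p + r *\<^sub>R y) \<bullet> y) \<partial>lborel)
      = (\<integral>y. (\<Sum>i\<in>Basis. ?I y * ((y \<bullet> i) * (grad (p + r *\<^sub>R y) \<bullet> i))) \<partial>lborel)"
    by (intro Bochner_Integration.integral_cong refl) (subst inner_swap, rule sum_distrib_left)
  also have "\<dots> = (\<Sum>i\<in>Basis. \<integral>y. ?I y * ((y \<bullet> i) * (grad (p + r *\<^sub>R y) \<bullet> i)) \<partial>lborel)"
    by (intro Bochner_Integration.integral_sum integrable_indicator_ball_continuous_on continuous_intros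
          continuous_on_compose2[OF continuous_grad]) auto
  also have "\<dots> = r * (\<Sum>i\<in>Basis. \<integral>y. ?I y * ((1 - (norm y)\<^sup>2) / 2 * (hess i (p + r *\<^sub>R y) \<bullet> i)) \<partial>lborel)"
    by (simp add: part sum_distrib_left)
  also have "(\<Sum>i\<in>Basis. \<integral>y. ?I y * ((1 - (norm y)\<^sup>2) / 2 * (hess i (p + r *\<^sub>R y) \<bullet> i)) \<partial>lborel)
      = (\<integral>y. (\<Sum>i\<in>Basis. ?I y * ((1 - (norm y)\<^sup>2) / 2 * (hess i (p + r *\<^sub>R y) \<bullet> i))) \<partial>lborel)"
    by (intro Bochner_Integration.integral_sum[symmetric] integrable_indicator_ball_continuous_on continuous_intros
          continuous_on_compose2[OF continuous_hessian]) auto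
  also have "\<dots> = (\<integral>y. ?I y * ((1 - (norm y)\<^sup>2) / 2 * laplacian (p + r *\<^sub>R y)) \<partial>lborel)"
    by (simp add: laplacian_def sum_distrib_left)
  finally show ?thesis .
qed

text \<open>
  The derivative in \<open>r\<close> is an integral of the Laplacian against a positive weight, so its sign is that of
  the Laplacian: averages of superharmonic functions decrease, those of subharmonic ones increase.
\<close>
lemma unit_ball_integral_has_derivative:
  "(unit_ball_integral p has_real_derivative
     r * (\<integral>y. indicator (ball 0 1) y * ((1 - (norm y)\<^sup>2) / 2 * laplacian (p + r *\<^sub>R y)) \<partial>lborel)) (at r)"
proof -
  let ?I = "\<lambda>y. indicator (ball (0::'a) 1) y :: real"
  obtain K where K: "K \<ge> 0"
    "\<And>x y. x \<in> cball p (\<bar>r\<bar> + 1) \<Longrightarrow> y \<in> cball p (\<bar>r\<bar> + 1) \<Longrightarrow> \<bar>f x - f y\<bar> \<le> K * norm (x - y)"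
    using lipschitz_on_ball_of_continuous_gradient[OF has_gradient continuous_grad] by blast
  have bound: "\<bar>?I y * f (p + t *\<^sub>R y) - ?I y * f (p + r *\<^sub>R y)\<bar> \<le> (?I y * K) * \<bar>t - r\<bar>"
    if "\<bar>t - r\<bar> < 1" for t y
  proof (cases "norm y < 1")
    case True
    have t: "\<bar>t\<bar> \<le> \<bar>r\<bar> + 1" using that by linarith
    have le: "\<bar>s\<bar> * norm y \<le> \<bar>s\<bar>" for s :: real
      using True mult_left_mono[of "norm y" 1 "\<bar>s\<bar>"] by simp
    have "\<bar>f (p + t *\<^sub>R y) - f (p + r *\<^sub>R y)\<bar> \<le> K * norm ((p + t *\<^sub>R y) - (p + r *\<^sub>R y))"
      using le[of t] le[of r] t by (intro K(2)) (auto simp: dist_norm)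
    also have "(p + t *\<^sub>R y) - (p + r *\<^sub>R y) = (t - r) *\<^sub>R y"
      by (simp add: algebra_simps)
    also have "K * norm ((t - r) *\<^sub>R y) \<le> K * \<bar>t - r\<bar>"
      using le[of "t - r"] K(1) by (intro mult_left_mono) auto
    finally show ?thesis using True by simp
  qed simp
  have int: "integrable lborel (\<lambda>y. ?I y * f (p + t *\<^sub>R y))" for t
    by (intro integrable_indicator_ball_continuous_on continuous_intros
          continuous_on_compose2[OF continuous_f]) auto
  have intK: "integrable lborel (\<lambda>y. ?I y * K)"
    by (intro integrable_indicator_ball_continuous_on continuous_intros)
  have deriv: "AE y in lborel. ((\<lambda>t. ?I y * f (p + t *\<^sub>R y)) has_real_derivative ?I y * (grad (p + r *\<^sub>R y) \<bullet> y)) (at r)"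
    by (intro AE_I2 DERIV_cmult DERIV_along_line has_gradient)
  have meas: "(\<lambda>y. ?I y * (grad (p + r *\<^sub>R y) \<bullet> y)) \<in> borel_measurable lborel"
    by measurable
  have "((\<lambda>t. \<integral>y. ?I y * f (p + t *\<^sub>R y) \<partial>lborel) has_real_derivative
      (\<integral>y. ?I y * (grad (p + r *\<^sub>R y) \<bullet> y) \<partial>lborel)) (at r)"
    by (rule has_real_derivative_integral[where \<phi> = "\<lambda>t y. ?I y * f (p + t *\<^sub>R y)", OF zero_less_one int intK bound deriv meas])
  thus ?thesis
    by (simp add: unit_ball_integral_def[abs_def] integral_grad_inner_eq_laplacian)
qed

lemma unit_ball_integral_mono_superharmonic:
  assumes "\<And>x. laplacian x \<le> 0" and "0 \<le> r" "r \<le> s"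
  shows "unit_ball_integral p s \<le> unit_ball_integral p r"
proof (rule DERIV_nonpos_imp_nonincreasing[OF assms(3)])
  fix t assume t: "r \<le> t" "t \<le> s"
  let ?h = "\<lambda>y. indicator (ball 0 1) y * ((1 - (norm y)\<^sup>2) / 2 * laplacian (p + t *\<^sub>R y))"
  have "0 \<le> (\<integral>y. - ?h y \<partial>lborel)"
    using assms(1)
    by (intro Bochner_Integration.integral_nonneg) (auto intro!: mult_nonneg_nonpos simp: indicator_def power_le_one)
  hence "(\<integral>y. ?h y \<partial>lborel) \<le> 0"
    by simp
  hence "t * (\<integral>y. ?h y \<partial>lborel) \<le> 0"
    using t assms(2) by (intro mult_nonneg_nonpos) auto
  thus "\<exists>y. (unit_ball_integral p has_real_derivative y) (at t) \<and> y \<le> 0"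
    using unit_ball_integral_has_derivative[of p t] by blast
qed

lemma unit_ball_integral_0: "unit_ball_integral p 0 = unit_ball_vol (DIM('a)) * f p"
  by (simp add: unit_ball_integral_def measure_def emeasure_ball)

lemma unit_ball_integral_gt:
  assumes "\<And>x. x \<in> ball p r \<Longrightarrow> laplacian x > 0" and "0 < r"
  shows "unit_ball_integral p r > unit_ball_vol (DIM('a)) * f p"
proof -
  let ?h = "\<lambda>t y. indicator (ball (0::'a) 1) y * ((1 - (norm y)\<^sup>2) / 2 * laplacian (p + t *\<^sub>R y))"
  have pos: "(\<integral>y. ?h t y \<partial>lborel) > 0" if t: "0 < t" "t < r" for t
  proof -
    have nonneg: "?h t y \<ge> 0" and pos: "norm y < 1 \<Longrightarrow> ?h t y > 0" for y
    proof -
      have "?h t y > 0" if y: "norm y < 1"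
      proof -
        have "t * norm y < r" using t y mult_left_le[of "norm y" t] by linarith
        hence "p + t *\<^sub>R y \<in> ball p r" using t y by (simp add: dist_norm)
        moreover have "(norm y)\<^sup>2 < 1" using y by (simp add: power_less_one_iff)
        ultimately show ?thesis using y assms(1) by simp
      qed
      thus "norm y < 1 \<Longrightarrow> ?h t y > 0" "?h t y \<ge> 0"
        by (cases "norm y < 1"; force)+
    qed
    have int: "integrable lborel (?h t)"
      by (intro integrable_indicator_ball_continuous_on continuous_intros
          continuous_on_compose2[OF continuous_laplacian]) auto
    have "(\<integral>y. ?h t y \<partial>lborel) \<noteq> 0"
    proof
      assume "(\<integral>y. ?h t y \<partial>lborel) = 0"
      hence "AE y in lborel. ?h t y = 0"
        using int nonneg by (subst (asm) integral_nonneg_eq_0_iff_AE) auto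
      hence "AE y in lborel. y \<notin> ball (0::'a) 1"
        by (rule eventually_mono) (use pos in force)
      thus False
        using not_AE_not_in_ball[of 1 "0::'a"] zero_less_one by blast
    qed
    moreover have "(\<integral>y. ?h t y \<partial>lborel) \<ge> 0"
      by (rule Bochner_Integration.integral_nonneg) (rule nonneg)
    ultimately show ?thesis by linarith
  qed
  have "unit_ball_integral p 0 < unit_ball_integral p r"
  proof (rule DERIV_pos_imp_increasing_open[OF assms(2)])
    show "\<exists>y. (unit_ball_integral p has_real_derivative y) (at t) \<and> y > 0" if "0 < t" "t < r" for t
      using unit_ball_integral_has_derivative[of p t] mult_pos_pos[OF that(1) pos[OF that]] by blast
    show "continuous_on {0..r} (unit_ball_integral p)"
      using unit_ball_integral_has_derivative DERIV_isCont by (intro continuous_at_imp_continuous_on) blast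
  qed
  thus ?thesis by (simp add: unit_ball_integral_0)
qed

end

definition radial_hessian :: "(real \<Rightarrow> real) \<Rightarrow> (real \<Rightarrow> real) \<Rightarrow> 'a \<Rightarrow> 'a::euclidean_space \<Rightarrow> 'a" where
  "radial_hessian G' G'' i x = (2 * G' (x \<bullet> x)) *\<^sub>R i + (4 * G'' (x \<bullet> x) * (x \<bullet> i)) *\<^sub>R x"

lemma C2_function_radial:
  fixes G G' G'' :: "real \<Rightarrow> real"
  assumes G': "\<And>s. s \<ge> 0 \<Longrightarrow> (G has_real_derivative G' s) (at s)"
    and G'': "\<And>s. s \<ge> 0 \<Longrightarrow> (G' has_real_derivative G'' s) (at s)"
    and cont: "continuous_on {0..} G''"
  shows "C2_function (\<lambda>x::'a::euclidean_space. G (x \<bullet> x)) (\<lambda>x. (2 * G' (x \<bullet> x)) *\<^sub>R x)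
           (radial_hessian G' G'')"
    and "C2_function.laplacian (radial_hessian G' G'') (x::'a) = 2 * DIM('a) * G' (x \<bullet> x) + 4 * (x \<bullet> x) * G'' (x \<bullet> x)"
proof -
  let ?H = "radial_hessian G' G'' :: 'a \<Rightarrow> 'a \<Rightarrow> 'a"
  have dinner: "((\<lambda>x::'a. x \<bullet> x) has_derivative (\<lambda>h. 2 * (x \<bullet> h))) (at x)" for x
    by (auto intro!: derivative_eq_intros simp: inner_commute)
  have comp: "((\<lambda>x::'a. F (x \<bullet> x)) has_derivative (\<lambda>h. D * (2 * (x \<bullet> h)))) (at x)"
    if "(F has_real_derivative D) (at (x \<bullet> x))" for F D x
    using diff_chain_at[OF dinner has_field_derivative_imp_has_derivative[OF that]] by (simp add: o_def)
  have contG': "continuous_on {0..} G'"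
    using G'' DERIV_isCont by (intro continuous_at_imp_continuous_on) auto
  show C2: "C2_function (\<lambda>x::'a. G (x \<bullet> x)) (\<lambda>x. (2 * G' (x \<bullet> x)) *\<^sub>R x) ?H"
  proof
    fix x :: 'a
    show "((\<lambda>x. G (x \<bullet> x)) has_derivative (\<lambda>h. ((2 * G' (x \<bullet> x)) *\<^sub>R x) \<bullet> h)) (at x)"
      using comp[OF G'] by (simp add: mult_ac)
  next
    fix x i :: 'a assume i: "i \<in> Basis"
    have "((\<lambda>x. x \<bullet> i) has_derivative (\<lambda>h. h \<bullet> i)) (at x)"
      by (auto intro!: derivative_eq_intros)
    from has_derivative_mult[OF comp[OF G'', OF inner_ge_zero] this]
    have "((\<lambda>x. G' (x \<bullet> x) * (x \<bullet> i)) has_derivative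
        (\<lambda>h. G' (x \<bullet> x) * (h \<bullet> i) + G'' (x \<bullet> x) * (2 * (x \<bullet> h)) * (x \<bullet> i))) (at x)"
      by simp
    from has_derivative_mult_right[OF this, of 2]
    show "((\<lambda>x. (2 * G' (x \<bullet> x)) *\<^sub>R x \<bullet> i) has_derivative (\<lambda>h. ?H i x \<bullet> h)) (at x)"
      by (simp add: radial_hessian_def inner_add_left inner_commute algebra_simps)
  next
    fix i :: 'a
    show "continuous_on UNIV (?H i)"
      unfolding radial_hessian_def
      by (intro continuous_intros continuous_on_compose2[OF contG'] continuous_on_compose2[OF cont]) auto
  qed
  have "(\<Sum>i\<in>Basis. ?H i x \<bullet> i) = (\<Sum>i\<in>(Basis::'a set). 2 * G' (x \<bullet> x) + 4 * G'' (x \<bullet> x) * ((x \<bullet> i) * (x \<bullet> i)))"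
    by (intro sum.cong refl) (simp add: radial_hessian_def inner_add_left inner_commute algebra_simps)
  also have "\<dots> = 2 * DIM('a) * G' (x \<bullet> x) + 4 * (x \<bullet> x) * G'' (x \<bullet> x)"
    unfolding sum.distrib sum_distrib_left[symmetric] euclidean_inner[of x x, symmetric] by simp
  finally show "C2_function.laplacian ?H x = 2 * DIM('a) * G' (x \<bullet> x) + 4 * (x \<bullet> x) * G'' (x \<bullet> x)"
    by (simp add: C2_function.laplacian_def[OF C2])
qed

section \<open>Dimension at most two\<close>

text \<open>
  The function \<open>x \<mapsto> M(B(x, r))\<close> is in general only lower semicontinuous; integrating the
  translates of a continuous \<open>\<phi>\<close> against \<open>M\<close> gives a continuous \<open>u\<close>. By Tonelli the averages of \<open>u\<close> over \<open>B(x, r)\<close>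
  do not decrease when \<open>r\<close> is halved. Along \<open>r / 2^k\<close> they tend to \<open>u(x)\<close>, which therefore dominates them all.
\<close>
lemma mollification_super_mean:
  fixes M :: "'a::euclidean_space measure" and \<phi> :: "'a \<Rightarrow> real"
  assumes M: "M \<in> doubling_minimizers"
    and cont: "continuous_on UNIV \<phi>" and nonneg: "\<And>z. \<phi> z \<ge> 0" and supp: "\<And>z. norm z \<ge> R \<Longrightarrow> \<phi> z = 0"
  defines "u \<equiv> \<lambda>x. \<integral>z. \<phi> (z - x) \<partial>M"
  shows "continuous_on UNIV u"
    and "\<And>x. u x \<ge> 0"
    and "\<And>x. (\<integral>\<^sup>+z. ennreal (\<phi> (z - x)) \<partial>M) = ennreal (u x)"
    and "\<And>x r. r > 0 \<Longrightarrow> (\<integral>\<^sup>+y\<in>ball x r. ennreal (u y) \<partial>lborel) \<le> emeasure lborel (ball x r) * ennreal (u x)"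
proof -
  from M have dbl: "doubling_measure M"
    and two: "\<And>x r. r > 0 \<Longrightarrow> emeasure M (ball x (2 * r)) \<le> ennreal (2 ^ DIM('a)) * emeasure M (ball x r)"
    by (auto simp: doubling_minimizers_iff)
  note sets_M [measurable_cong] = sets_doubling_measure[OF dbl]
  have space_M: "space M = UNIV"
    using sets_eq_imp_space_eq[OF sets_M] by simp
  interpret M: sigma_finite_measure M
    by (rule sigma_finite_doubling_measure[OF dbl])
  have [measurable]: "\<phi> \<in> borel_measurable borel"
    by (rule borel_measurable_continuous_onI[OF cont])
  have "compact (\<phi> ` cball 0 R)"
    using cont by (intro compact_continuous_image) (auto intro: continuous_on_subset)
  then obtain B where "B > 0" and "\<forall>y\<in>\<phi> ` cball 0 R. norm y \<le> B"
    using compact_imp_bounded[of "\<phi> ` cball 0 R"] unfolding bounded_pos by blast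
  hence B: "\<phi> z \<le> B" for z
    using supp[of z] by (cases "norm z \<le> R") (auto simp: abs_le_iff)
  have bound: "norm (\<phi> (z - x)) \<le> B * indicator (ball 0 (R + S)) z" if "norm x \<le> S" for z x S
  proof (cases "norm z < R + S")
    case False
    hence "norm (z - x) \<ge> R"
      using norm_triangle_ineq2[of z x] that by linarith
    thus ?thesis using False by (simp add: supp)
  qed (use B nonneg in simp)
  have bound_int: "integrable M (\<lambda>z. B * indicator (ball (0::'a) (R + S)) z)" for S
    using doubling_measure_ball_finite[OF dbl, of 0 "R + S"]
    by (intro integrable_mult_right integrable_real_indicator) (auto simp: sets_M)
  have int: "integrable M (\<lambda>z. \<phi> (z - x))" for x
    by (rule Bochner_Integration.integrable_bound[OF bound_int[of "norm x"]])
       (use bound[of x "norm x"] \<open>B > 0\<close> in \<open>auto simp: abs_mult intro!: AE_I2\<close>)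
  show u_nonneg: "u x \<ge> 0" for x
    unfolding u_def by (intro Bochner_Integration.integral_nonneg nonneg)
  show u_eq: "(\<integral>\<^sup>+z. ennreal (\<phi> (z - x)) \<partial>M) = ennreal (u x)" for x
    unfolding u_def by (intro nn_integral_eq_integral int) (simp add: nonneg)
  show u_cont: "continuous_on UNIV u"
    unfolding continuous_on_sequentially o_def
  proof safe
    fix X :: "nat \<Rightarrow> 'a" and x assume X: "X \<longlonglongrightarrow> x"
    then obtain S where S: "\<And>n. norm (X n) \<le> S"
      using convergent_imp_Bseq[of X] by (auto simp: convergent_def Bseq_def)
    show "(\<lambda>n. u (X n)) \<longlonglongrightarrow> u x"
      unfolding u_def
    proof (rule integral_dominated_convergence[OF _ _ bound_int[of S]])
      show "AE z in M. (\<lambda>i. \<phi> (z - X i)) \<longlonglongrightarrow> \<phi> (z - x)"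
        using cont X by (intro AE_I2 continuous_on_tendsto_compose[of UNIV \<phi>] tendsto_intros) auto
      show "AE z in M. norm (\<phi> (z - X i)) \<le> B * indicator (ball 0 (R + S)) z" for i
        by (intro AE_I2 bound S)
    qed measurable
  qed
  hence [measurable]: "u \<in> borel_measurable borel"
    by (rule borel_measurable_continuous_onI)
  define I where "I = (\<lambda>x r. \<integral>\<^sup>+y\<in>ball x r. ennreal (u y) \<partial>lborel)"
  have I_eq: "I x r = (\<integral>\<^sup>+w. ennreal (\<phi> w) * emeasure M (ball (x + w) r) \<partial>lborel)" for x r
    unfolding I_def u_eq[symmetric]
    by (rule nn_integral_ball_mollified[OF M.sigma_finite_measure_axioms sets_M]) measurable
  have [measurable]: "(\<lambda>w. emeasure M (ball (x + w :: 'a) \<rho>)) \<in> borel_measurable borel" for x \<rho>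
    by (rule measurable_emeasure_ball[OF M.sigma_finite_measure_axioms sets_M])
  have I_double: "I x (2 * r) \<le> ennreal (2 ^ DIM('a)) * I x r" if "r > 0" for x r
  proof -
    have "I x (2 * r) \<le> (\<integral>\<^sup>+w. ennreal (2 ^ DIM('a)) * (ennreal (\<phi> w) * emeasure M (ball (x + w) r)) \<partial>lborel)"
      unfolding I_eq using two[OF that]
      by (intro nn_integral_mono) (metis mult.left_commute mult_left_mono zero_le)
    also have "\<dots> = ennreal (2 ^ DIM('a)) * I x r"
      unfolding I_eq by (rule nn_integral_cmult) measurable
    finally show ?thesis .
  qed
  have I_iter: "I x r \<le> ennreal (2 ^ (DIM('a) * k)) * I x (r / 2 ^ k)" if "r > 0" for x r k
  proof (induction k)
    case (Suc k)
    have "I x (r / 2 ^ k) \<le> ennreal (2 ^ DIM('a)) * I x (r / 2 ^ Suc k)"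
      using I_double[of "r / 2 ^ Suc k" x] that by simp
    hence "ennreal (2 ^ (DIM('a) * k)) * I x (r / 2 ^ k)
        \<le> ennreal (2 ^ (DIM('a) * k)) * (ennreal (2 ^ DIM('a)) * I x (r / 2 ^ Suc k))"
      by (rule mult_left_mono) simp
    also have "\<dots> = ennreal (2 ^ (DIM('a) * Suc k)) * I x (r / 2 ^ Suc k)"
      by (simp add: power_add mult_ac ennreal_mult[symmetric] flip: mult.assoc)
    finally show ?case using Suc by simp
  qed simp
  fix x :: 'a and r :: real assume r: "r > 0"
  let ?V = "unit_ball_vol (real DIM('a))"
  have I_le: "I x r \<le> ennreal (?V * r ^ DIM('a) * (u x + \<epsilon>))" if "\<epsilon> > 0" for \<epsilon>
  proof -
    have "isCont u x"
      using u_cont by (simp add: continuous_on_eq_continuous_at)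
    then obtain \<rho> where \<rho>: "\<rho> > 0" "\<And>y. dist y x < \<rho> \<Longrightarrow> dist (u y) (u x) < \<epsilon>"
      using \<open>\<epsilon> > 0\<close> by (auto simp: continuous_at_eps_delta)
    obtain k where k: "r / \<rho> < 2 ^ k"
      using real_arch_pow[of 2] by auto
    hence k': "r / 2 ^ k < \<rho>"
      using \<rho>(1) by (simp add: field_simps)
    have "I x (r / 2 ^ k) \<le> (\<integral>\<^sup>+y. ennreal (u x + \<epsilon>) * indicator (ball x (r / 2 ^ k)) y \<partial>lborel)"
      unfolding I_def
    proof (intro nn_integral_mono)
      fix y
      have "u y \<le> u x + \<epsilon>" if "dist x y < r / 2 ^ k"
        using \<rho>(2)[of y] that k' by (simp add: dist_commute dist_real_def abs_less_iff)
      thus "ennreal (u y) * indicator (ball x (r / 2 ^ k)) y \<le> ennreal (u x + \<epsilon>) * indicator (ball x (r / 2 ^ k)) y"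
        by (auto simp: indicator_def intro: ennreal_leI)
    qed
    also have "\<dots> = ennreal ((u x + \<epsilon>) * (?V * (r / 2 ^ k) ^ DIM('a)))"
      using r u_nonneg[of x] that by (subst nn_integral_cmult_indicator) (auto simp: emeasure_ball ennreal_mult)
    finally have "ennreal (2 ^ (DIM('a) * k)) * I x (r / 2 ^ k)
        \<le> ennreal (2 ^ (DIM('a) * k)) * ennreal ((u x + \<epsilon>) * (?V * (r / 2 ^ k) ^ DIM('a)))"
      by (rule mult_left_mono) simp
    also have "\<dots> = ennreal (2 ^ (DIM('a) * k) * ((u x + \<epsilon>) * (?V * (r / 2 ^ k) ^ DIM('a))))"
      using r u_nonneg[of x] that by (subst ennreal_mult) auto
    also have "2 ^ (DIM('a) * k) * ((u x + \<epsilon>) * (?V * (r / 2 ^ k) ^ DIM('a))) = ?V * r ^ DIM('a) * (u x + \<epsilon>)"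
      by (simp add: power_divide mult.commute[of "DIM('a)" k] flip: power_mult)
    finally show ?thesis using I_iter[OF r, of x k] by simp
  qed
  have "(\<lambda>m. ennreal (?V * r ^ DIM('a) * (u x + 1 / real (Suc m)))) \<longlonglongrightarrow> ennreal (?V * r ^ DIM('a) * (u x + 0))"
    using LIMSEQ_inverse_real_of_nat by (intro tendsto_ennrealI tendsto_intros) (simp add: inverse_eq_divide)
  hence "I x r \<le> ennreal (?V * r ^ DIM('a) * (u x + 0))"
    using I_le by (intro tendsto_lowerbound[where F = sequentially]) (auto intro!: always_eventually)
  also have "\<dots> = emeasure lborel (ball x r) * ennreal (u x)"
    using r u_nonneg[of x] by (simp add: emeasure_ball ennreal_mult)
  finally show "(\<integral>\<^sup>+y\<in>ball x r. ennreal (u y) \<partial>lborel) \<le> emeasure lborel (ball x r) * ennreal (u x)"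
    unfolding I_def .
qed

lemma nn_integral_ball_eq_unit_ball_integral:
  fixes u :: "'a::euclidean_space \<Rightarrow> real"
  assumes cont: "continuous_on UNIV u" and nonneg: "\<And>x. u x \<ge> 0" and r: "r > 0"
  shows "(\<integral>\<^sup>+y\<in>ball x r. ennreal (u y) \<partial>lborel)
    = ennreal (r ^ DIM('a) * (\<integral>y. indicator (ball 0 1) y * u (x + r *\<^sub>R y) \<partial>lborel))"
proof -
  have [measurable]: "u \<in> borel_measurable borel"
    by (rule borel_measurable_continuous_onI[OF cont])
  have int: "integrable lborel (\<lambda>y. indicator (ball 0 1) y * u (x + r *\<^sub>R y))"
    by (intro integrable_indicator_ball_continuous_on continuous_intros continuous_on_compose2[OF cont]) auto
  have "(\<integral>\<^sup>+y\<in>ball x r. ennreal (u y) \<partial>lborel)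
      = ennreal (r ^ DIM('a)) * (\<integral>\<^sup>+y. ennreal (u (x + r *\<^sub>R y)) * indicator (ball x r) (x + r *\<^sub>R y) \<partial>lborel)"
    using r by (subst nn_integral_lborel_affine[of _ r x]) auto
  also have "(\<integral>\<^sup>+y. ennreal (u (x + r *\<^sub>R y)) * indicator (ball x r) (x + r *\<^sub>R y) \<partial>lborel)
      = (\<integral>\<^sup>+y. ennreal (indicator (ball 0 1) y * u (x + r *\<^sub>R y)) \<partial>lborel)"
    using r by (intro nn_integral_cong) (auto simp: indicator_def dist_norm)
  also have "\<dots> = ennreal (\<integral>y. indicator (ball 0 1) y * u (x + r *\<^sub>R y) \<partial>lborel)"
    using int nonneg by (intro nn_integral_eq_integral) auto
  finally show ?thesis
    using r nonneg by (simp add: ennreal_mult)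
qed

text \<open>
  In dimension at most \<open>2\<close> there are strictly subharmonic functions near infinity that tend to \<open>-\<infinity>\<close>: in
  the plane, any strictly convex function of \<open>log |x|\<close>, such as \<open>- log (log |x|)\<close>, which
  is also convex on the line. Adding the two ones makes it smooth on the whole space, at the price of losing
  subharmonicity near the origin.
  The argument stands for \<open>|x|^2\<close>.
\<close>
definition neg_log_log :: "real \<Rightarrow> real" where
  "neg_log_log s = - ln (1 + ln (1 + s))"

lemma neg_log_log_subharmonic:
  assumes "DIM('a::euclidean_space) \<le> 2"
  obtains gr hs where "C2_function (\<lambda>x::'a. neg_log_log (x \<bullet> x)) gr hs"
    "\<And>x. x \<bullet> x \<ge> 3 \<Longrightarrow> C2_function.laplacian hs x > 0"
proof -
  define G1 where "G1 = (\<lambda>s::real. - 1 / ((1 + s) * (1 + ln (1 + s))))"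
  define G2 where "G2 = (\<lambda>s::real. (2 + ln (1 + s)) / ((1 + s) * (1 + ln (1 + s)))\<^sup>2)"
  have pos: "1 + ln (1 + s) > 0" if "s \<ge> 0" for s :: real
    using ln_ge_zero[of "1 + s"] that by linarith
  have d1: "(neg_log_log has_real_derivative G1 s) (at s)" if "s \<ge> 0" for s
    unfolding neg_log_log_def[abs_def] G1_def using that pos[OF that]
    by (auto intro!: derivative_eq_intros simp: field_simps)
  have d2: "(G1 has_real_derivative G2 s) (at s)" if "s \<ge> 0" for s
    unfolding G1_def G2_def using that pos[OF that]
    by (auto intro!: derivative_eq_intros simp: power2_eq_square divide_simps)
  have nz: "1 + ln (1 + s) \<noteq> 0" "1 + s \<noteq> 0" if "s \<ge> 0" for s :: real
    using pos[OF that] that by linarith+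
  have cont: "continuous_on {0..} G2"
    unfolding G2_def by (intro continuous_intros ballI) (auto dest: nz)
  note C2 = C2_function_radial[where 'a = 'a, OF d1 d2 cont, simplified]
  show ?thesis
  proof (rule that[OF C2(1)])
    fix x :: 'a assume x: "x \<bullet> x \<ge> 3"
    define s where "s = x \<bullet> x"
    define l where "l = ln (1 + s)"
    have s: "s \<ge> 3" using x by (simp add: s_def)
    have "l \<ge> 0" using s by (simp add: l_def)
    have "l < s - 1"
    proof -
      have "l = ln 4 + ln ((1 + s) / 4)"
        unfolding l_def using s by (simp add: ln_div)
      also have "ln ((1 + s) / 4) \<le> (1 + s) / 4 - 1"
        using s by (intro ln_le_minus_one) auto
      also have "ln 4 = 2 * ln (2::real)"
        using ln_realpow[of 2 2] by simp
      also have "ln (2::real) < 1"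
        by (rule ln_2_less_1)
      finally have "l < 2 + ((1 + s) / 4 - 1)" by simp
      thus ?thesis using s by (simp add: field_simps)
    qed
    have d: "DIM('a) \<le> (2::real)" using assms by simp
    have G1_neg: "G1 s \<le> 0"
      unfolding G1_def l_def[symmetric] using s \<open>l \<ge> 0\<close> by (simp add: divide_nonpos_nonneg)
    \<comment> \<open>This is the Laplacian in the plane; on the line it is larger because \<open>G1\<close> is negative.\<close>
    have "0 < 4 * ((s - 1 - l) / ((1 + s) * (1 + l))\<^sup>2)"
      using s \<open>l \<ge> 0\<close> \<open>l < s - 1\<close> by (intro mult_pos_pos divide_pos_pos) auto
    also have "\<dots> = 4 * G1 s + 4 * s * G2 s"
      unfolding G1_def G2_def l_def[symmetric] using s \<open>l \<ge> 0\<close>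
      by (simp add: divide_simps power2_eq_square) (simp add: algebra_simps)
    also have "4 * G1 s \<le> 2 * DIM('a) * G1 s"
      using d G1_neg by (intro mult_right_mono_neg) auto
    finally show "C2_function.laplacian (radial_hessian G1 G2) x > 0"
      unfolding C2(2) s_def by simp
  qed
qed

text \<open>
  A Liouville theorem. Let \<open>m\<close> be the minimum of \<open>u\<close> over the closed ball of radius \<open>2\<close>. Outside,
  \<open>u\<close> stays above \<open>m + \<epsilon> H\<close>, where \<open>H\<close> is the comparison function shifted to vanish at radius \<open>2\<close>: the
  difference is nonnegative at radius \<open>2\<close> and near infinity, and it cannot have a negative interior minimum,
  because there its averages would be strictly smaller than its value. With \<open>\<epsilon>\<close> tending to \<open>0\<close>, \<open>m\<close> is a
  global minimum that is attained, and the mean value inequality at that point forces \<open>u = m\<close> on every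
  ball around it.
\<close>
lemma super_mean_constant:
  fixes u :: "'a::euclidean_space \<Rightarrow> real"
  assumes dim: "DIM('a) \<le> 2"
    and cont: "continuous_on UNIV u" and nonneg: "\<And>x. u x \<ge> 0"
    and super_mean: "\<And>x r. r > 0 \<Longrightarrow>
      (\<integral>\<^sup>+y\<in>ball x r. ennreal (u y) \<partial>lborel) \<le> emeasure lborel (ball x r) * ennreal (u x)"
  shows "u x = u y"
proof -
  let ?V = "unit_ball_vol (real DIM('a))"
  let ?I = "\<lambda>y. indicator (ball (0::'a) 1) y :: real"
  have V: "?V > 0" by simp
  have int: "integrable lborel (\<lambda>y. ?I y * h (x + r *\<^sub>R y))" if "continuous_on UNIV h" for h :: "'a \<Rightarrow> real" and x r
    by (intro integrable_indicator_ball_continuous_on continuous_intros continuous_on_compose2[OF that]) auto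
  have const: "(\<integral>y. ?I y * c \<partial>lborel) = ?V * c" for c
    by (simp add: measure_def emeasure_ball)
  have mean: "(\<integral>y. ?I y * u (x + r *\<^sub>R y) \<partial>lborel) \<le> ?V * u x" if r: "r > 0" for x r
  proof -
    have "ennreal (r ^ DIM('a) * (\<integral>y. ?I y * u (x + r *\<^sub>R y) \<partial>lborel)) \<le> ennreal (?V * r ^ DIM('a)) * ennreal (u x)"
      using super_mean[OF r, of x] r
      by (simp add: nn_integral_ball_eq_unit_ball_integral[OF cont nonneg r] emeasure_ball)
    also have "\<dots> = ennreal (r ^ DIM('a) * (?V * u x))"
      using r nonneg[of x] by (simp add: mult_ac flip: ennreal_mult)
    finally have "r ^ DIM('a) * (\<integral>y. ?I y * u (x + r *\<^sub>R y) \<partial>lborel) \<le> r ^ DIM('a) * (?V * u x)"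
      using r nonneg[of x] by (subst (asm) ennreal_le_iff) auto
    thus ?thesis using r by simp
  qed
  obtain x0 where x0: "x0 \<in> cball 0 2" "\<And>x. x \<in> cball 0 2 \<Longrightarrow> u x0 \<le> u x"
    using continuous_attains_inf[OF compact_cball, of "0::'a" 2 u] continuous_on_subset[OF cont]
    by (metis cball_eq_empty not_numeral_less_zero subset_UNIV)
  obtain gr hs where C2: "C2_function (\<lambda>x::'a. neg_log_log (x \<bullet> x)) gr hs"
    and lap: "\<And>x. x \<bullet> x \<ge> 3 \<Longrightarrow> C2_function.laplacian hs x > 0"
    using neg_log_log_subharmonic[OF dim] by blast
  define H where "H = (\<lambda>x::'a. neg_log_log (x \<bullet> x) - neg_log_log 4)"
  have neg_log_log_cont: "continuous_on UNIV (\<lambda>x::'a. neg_log_log (x \<bullet> x))"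
    by (rule C2_function.continuous_f[OF C2])
  have outside: "u x \<ge> u x0 + \<epsilon> * H x" if x: "norm x > 2" and \<epsilon>: "\<epsilon> > 0" for x \<epsilon>
  proof (rule ccontr)
    assume neg: "\<not> ?thesis"
    define v where "v = (\<lambda>x. u x - u x0 - \<epsilon> * H x)"
    have v_cont: "continuous_on UNIV v"
      unfolding v_def H_def by (intro continuous_intros cont neg_log_log_cont)
    \<comment> \<open>Chosen so that \<open>- \<epsilon> H\<close> alone exceeds \<open>u x0\<close> beyond radius \<open>R\<close>.\<close>
    define R where "R = max 3 (exp (exp (u x0 / \<epsilon> - neg_log_log 4)))"
    have far: "v y \<ge> 0" if "norm y \<ge> R" for y
    proof -
      have "exp (exp (u x0 / \<epsilon> - neg_log_log 4)) \<le> norm y" "norm y \<ge> 1"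
        using that by (auto simp: R_def)
      moreover have "norm y * 1 \<le> norm y * norm y"
        using \<open>norm y \<ge> 1\<close> by (intro mult_left_mono) auto
      ultimately have "exp (exp (u x0 / \<epsilon> - neg_log_log 4)) \<le> 1 + y \<bullet> y"
        by (simp add: dot_square_norm power2_eq_square)
      hence "exp (u x0 / \<epsilon> - neg_log_log 4) \<le> ln (1 + y \<bullet> y)"
        by (subst ln_ge_iff) (auto simp: add_pos_nonneg)
      hence "exp (u x0 / \<epsilon> - neg_log_log 4) \<le> 1 + ln (1 + y \<bullet> y)"
        by simp
      hence "u x0 / \<epsilon> - neg_log_log 4 \<le> ln (1 + ln (1 + y \<bullet> y))"
        by (subst ln_ge_iff) (auto intro: less_le_trans[OF exp_gt_zero])
      hence "u x0 / \<epsilon> \<le> - H y" by (simp add: H_def neg_log_log_def)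
      hence "u x0 \<le> \<epsilon> * (- H y)" using \<epsilon> by (simp add: field_simps)
      thus ?thesis using nonneg[of y] by (simp add: v_def)
    qed
    have near: "v y \<ge> 0" if "norm y = 2" for y
      using x0(2)[of y] that by (simp add: v_def H_def dot_square_norm)
    have vx: "v x < 0" using neg by (simp add: v_def)
    define A where "A = cball (0::'a) R - ball 0 2"
    have "x \<in> A" using x vx far[of x] by (auto simp: A_def not_le[symmetric])
    moreover have "compact A" unfolding A_def by (intro compact_diff) auto
    ultimately obtain y where y: "y \<in> A" "\<And>z. z \<in> A \<Longrightarrow> v y \<le> v z"
      using continuous_attains_inf[of A v] v_cont by (auto intro: continuous_on_subset)
    have vy: "v y < 0" using y(2)[OF \<open>x \<in> A\<close>] vx by simp
    have yR: "2 < norm y" "norm y < R"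
      using y(1) near[of y] far[of y] vy by (auto simp: A_def less_le not_less)
    define r where "r = min (norm y - 2) (R - norm y)"
    have r: "r > 0" using yR by (simp add: r_def)
    have ball_A: "z \<in> A \<and> z \<bullet> z \<ge> 3" if "z \<in> ball y r" for z
    proof -
      have "norm (z - y) < r" using that by (simp add: dist_norm norm_minus_commute)
      moreover have "norm z \<le> norm y + norm (z - y)" using norm_triangle_sub by blast
      moreover have "norm y \<le> norm z + norm (z - y)" by (metis norm_minus_commute norm_triangle_sub)
      ultimately have z: "2 \<le> norm z" "norm z \<le> R" by (auto simp: r_def)
      have "2 * 2 \<le> norm z * norm z" using z by (intro mult_mono) auto
      with z show ?thesis by (simp add: A_def dot_square_norm power2_eq_square)
    qed
    \<comment> \<open>\<open>v\<close> is minimal at \<open>y\<close> within the ball, yet its average there is below \<open>v y\<close>.\<close>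
    have "?V * v y = (\<integral>z. ?I z * v y \<partial>lborel)" by (simp only: const)
    also have "\<dots> \<le> (\<integral>z. ?I z * v (y + r *\<^sub>R z) \<partial>lborel)"
    proof (rule integral_mono)
      show "integrable lborel (\<lambda>z. ?I z * v y)"
        by (intro integrable_indicator_ball_continuous_on continuous_intros)
      show "integrable lborel (\<lambda>z. ?I z * v (y + r *\<^sub>R z))" by (rule int[OF v_cont])
      fix z
      have "v y \<le> v (y + r *\<^sub>R z)" if "norm z < 1"
        using that r by (intro y(2) conjunct1[OF ball_A]) (simp add: dist_norm)
      thus "?I z * v y \<le> ?I z * v (y + r *\<^sub>R z)"
        by (simp add: indicator_def)
    qed
    also have "(\<integral>z. ?I z * v (y + r *\<^sub>R z) \<partial>lborel)
        = (\<integral>z. ?I z * u (y + r *\<^sub>R z) \<partial>lborel) - ?V * (u x0 - \<epsilon> * neg_log_log 4)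
          - \<epsilon> * (\<integral>z. ?I z * neg_log_log ((y + r *\<^sub>R z) \<bullet> (y + r *\<^sub>R z)) \<partial>lborel)"
    proof -
      let ?L = "\<lambda>z. neg_log_log ((y + r *\<^sub>R z) \<bullet> (y + r *\<^sub>R z))" and ?c = "u x0 - \<epsilon> * neg_log_log 4"
      have c_int: "integrable lborel (\<lambda>z. ?I z * ?c)"
        by (intro integrable_indicator_ball_continuous_on continuous_intros)
      have "(\<integral>z. ?I z * v (y + r *\<^sub>R z) \<partial>lborel)
          = (\<integral>z. (?I z * u (y + r *\<^sub>R z) - ?I z * ?c) - \<epsilon> * (?I z * ?L z) \<partial>lborel)"
        by (intro Bochner_Integration.integral_cong refl) (simp add: v_def H_def indicator_def algebra_simps)
      also have "\<dots> = (\<integral>z. ?I z * u (y + r *\<^sub>R z) - ?I z * ?c \<partial>lborel) - (\<integral>z. \<epsilon> * (?I z * ?L z) \<partial>lborel)"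
        by (rule Bochner_Integration.integral_diff
              [OF Bochner_Integration.integrable_diff[OF int[OF cont] c_int] integrable_mult_right[OF int[OF neg_log_log_cont]]])
      also have "(\<integral>z. ?I z * u (y + r *\<^sub>R z) - ?I z * ?c \<partial>lborel) = (\<integral>z. ?I z * u (y + r *\<^sub>R z) \<partial>lborel) - ?V * ?c"
        unfolding Bochner_Integration.integral_diff[OF int[OF cont] c_int] const ..
      also have "(\<integral>z. \<epsilon> * (?I z * ?L z) \<partial>lborel) = \<epsilon> * (\<integral>z. ?I z * ?L z \<partial>lborel)"
        by (rule integral_mult_right_zero)
      finally show ?thesis .
    qed
    also have "\<dots> < ?V * u y - ?V * (u x0 - \<epsilon> * neg_log_log 4) - \<epsilon> * (?V * neg_log_log (y \<bullet> y))"
    proof -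
      have "?V * neg_log_log (y \<bullet> y) < (\<integral>z. ?I z * neg_log_log ((y + r *\<^sub>R z) \<bullet> (y + r *\<^sub>R z)) \<partial>lborel)"
        using C2_function.unit_ball_integral_gt[OF C2 lap r, of y] ball_A
        unfolding C2_function.unit_ball_integral_def[OF C2] by blast
      from mult_strict_left_mono[OF this \<epsilon>] mean[OF r, of y] show ?thesis
        by linarith
    qed
    also have "\<dots> = ?V * v y"
      by (simp add: v_def H_def algebra_simps)
    finally show False by simp
  qed
  have min: "u x \<ge> u x0" for x
  proof (cases "norm x \<le> 2")
    case False
    show ?thesis
    proof (rule field_le_epsilon)
      fix e :: real assume "e > 0"
      define \<epsilon> where "\<epsilon> = e / (\<bar>H x\<bar> + 1)"
      have "\<epsilon> > 0" using \<open>e > 0\<close> by (simp add: \<epsilon>_def)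
      have "- (\<epsilon> * H x) \<le> \<epsilon> * (\<bar>H x\<bar> + 1)"
        using mult_left_mono[of "- H x" "\<bar>H x\<bar> + 1" \<epsilon>] \<open>\<epsilon> > 0\<close> by simp
      also have "\<dots> = e" by (simp add: \<epsilon>_def)
      finally show "u x0 \<le> u x + e"
        using outside[of x \<epsilon>] False \<open>\<epsilon> > 0\<close> by simp
    qed
  qed (use x0 in simp)
  have eq: "u z = u x0" for z
  proof -
    define r where "r = dist x0 z + 1"
    have r: "r > 0" by (simp add: r_def add_nonneg_pos)
    define h where "h = (\<lambda>y. u (x0 + r *\<^sub>R y) - u x0)"
    have h_cont: "continuous_on UNIV h"
      unfolding h_def by (intro continuous_intros continuous_on_compose2[OF cont]) auto
    have c_int: "integrable lborel (\<lambda>y. ?I y * u x0)"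
      by (intro integrable_indicator_ball_continuous_on continuous_intros)
    have "(\<integral>y. ?I y * h y \<partial>lborel) = (\<integral>y. ?I y * u (x0 + r *\<^sub>R y) - ?I y * u x0 \<partial>lborel)"
      by (simp add: h_def algebra_simps)
    also have "\<dots> = (\<integral>y. ?I y * u (x0 + r *\<^sub>R y) \<partial>lborel) - ?V * u x0"
      unfolding Bochner_Integration.integral_diff[OF int[OF cont] c_int] const ..
    also have "\<dots> \<le> 0" using mean[OF r, of x0] by simp
    finally have le: "(\<integral>y. ?I y * h y \<partial>lborel) \<le> 0" .
    have nn: "?I y * h y \<ge> 0" for y using min by (simp add: h_def)
    have "(\<integral>y. ?I y * h y \<partial>lborel) = 0"
      using le Bochner_Integration.integral_nonneg[of lborel "\<lambda>y. ?I y * h y"] nn by (simp add: order_antisym)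
    hence "AE y in lborel. ?I y * h y = 0"
      using integrable_indicator_ball_continuous_on[OF h_cont, of 0 1] nn
      by (subst (asm) integral_nonneg_eq_0_iff_AE) auto
    hence AE: "AE y in lborel. y \<in> ball 0 1 \<longrightarrow> h y = 0"
      by (rule eventually_mono) (simp add: indicator_def split: if_splits)
    have "h ((1 / r) *\<^sub>R (z - x0)) = 0"
      by (rule continuous_AE_eq_0[OF open_ball _ continuous_on_subset[OF h_cont] AE])
         (use r in \<open>auto simp: r_def dist_norm norm_minus_commute\<close>)
    thus ?thesis using r by (simp add: h_def)
  qed
  show ?thesis unfolding eq[of x] eq[of y] ..
qed

text \<open>
  Each mollification is constant, so the measure integrates every \<open>\<phi>\<close> like its translates. Indicators of
  bounded open sets are increasing limits of such \<open>\<phi>\<close>.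
\<close>
lemma minimizer_translation_invariant:
  fixes M :: "'a::euclidean_space measure"
  assumes dim: "DIM('a) \<le> 2" and M: "M \<in> doubling_minimizers"
  shows "distr M borel (\<lambda>z. z - x) = M"
proof -
  from M have dbl: "doubling_measure M" by (simp add: doubling_minimizers_iff)
  note sets_M [measurable_cong] = sets_doubling_measure[OF dbl]
  have open_eq: "emeasure (distr M borel (\<lambda>z. z - x)) U = emeasure M U"
    if U: "open U" "bounded U" for U x
  proof -
    from U(2) obtain R where R: "\<And>z. z \<in> U \<Longrightarrow> norm z < R"
      unfolding bounded_pos by (metis le_less_trans less_add_one)
    have ne: "- U \<noteq> {}" using U(2) not_bounded_UNIV[where 'a = 'a] by (metis Compl_empty_eq double_complement)
    have [measurable]: "U \<in> sets borel" using U(1) by simp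
    define \<phi> where "\<phi> = (\<lambda>k z. min 1 (real k * infdist z (- U)))"
    have \<phi>_cont: "continuous_on UNIV (\<phi> k)" for k
      unfolding \<phi>_def by (intro continuous_intros)
    have [measurable]: "\<phi> k \<in> borel_measurable borel" for k
      by (rule borel_measurable_continuous_onI[OF \<phi>_cont])
    have \<phi>_nonneg: "\<phi> k z \<ge> 0" for k z by (simp add: \<phi>_def infdist_nonneg)
    have \<phi>_supp: "\<phi> k z = 0" if "norm z \<ge> R" for k z
    proof -
      have "z \<in> - U" using R[of z] that by force
      thus ?thesis by (simp add: \<phi>_def)
    qed
    have const: "(\<integral>\<^sup>+z. ennreal (\<phi> k (z - x)) \<partial>M) = (\<integral>\<^sup>+z. ennreal (\<phi> k (z - 0)) \<partial>M)" for k x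
    proof -
      let ?u = "\<lambda>x. \<integral>z. \<phi> k (z - x) \<partial>M"
      have eq: "(\<integral>\<^sup>+z. ennreal (\<phi> k (z - x)) \<partial>M) = ennreal (?u x)" for x
        by (rule mollification_super_mean(3)[OF M \<phi>_cont \<phi>_nonneg \<phi>_supp])
      have "?u x = ?u 0"
      proof (rule super_mean_constant[OF dim])
        show "continuous_on UNIV ?u"
          by (rule mollification_super_mean(1)[OF M \<phi>_cont \<phi>_nonneg \<phi>_supp])
        show "?u x \<ge> 0" for x
          by (rule mollification_super_mean(2)[OF M \<phi>_cont \<phi>_nonneg \<phi>_supp])
        show "(\<integral>\<^sup>+y\<in>ball x r. ennreal (?u y) \<partial>lborel) \<le> emeasure lborel (ball x r) * ennreal (?u x)"
          if "r > 0" for x r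
          by (rule mollification_super_mean(4)[OF M \<phi>_cont \<phi>_nonneg \<phi>_supp that])
      qed
      thus ?thesis unfolding eq by simp
    qed
    have lim: "(\<lambda>k. ennreal (\<phi> k z)) \<longlonglongrightarrow> indicator U z" for z
    proof (cases "z \<in> U")
      case True
      hence d: "infdist z (- U) > 0"
        using ne U(1) by (intro infdist_pos_not_in_closed) auto
      obtain N where N: "1 / infdist z (- U) < real N"
        using reals_Archimedean2 by blast
      have "\<phi> k z = 1" if "k \<ge> N" for k
      proof -
        have "1 \<le> real N * infdist z (- U)" using N d by (simp add: field_simps)
        also have "\<dots> \<le> real k * infdist z (- U)" using that d by (intro mult_right_mono) auto
        finally show ?thesis by (simp add: \<phi>_def)
      qed
      thus ?thesis using True by (intro tendsto_eventually) (auto simp: eventually_sequentially)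
    qed (simp add: \<phi>_def)
    have inc: "incseq (\<lambda>k z. ennreal (\<phi> k (z - x)))" for x
      unfolding \<phi>_def
      by (intro incseq_SucI le_funI ennreal_leI min.mono mult_right_mono infdist_nonneg) auto
    have tend: "(\<lambda>k. \<integral>\<^sup>+z. ennreal (\<phi> k (z - x)) \<partial>M) \<longlonglongrightarrow> (\<integral>\<^sup>+z. indicator U (z - x) \<partial>M)" for x
      by (rule nn_integral_LIMSEQ[OF inc _ lim]) measurable
    have "(\<integral>\<^sup>+z. indicator U (z - x) \<partial>M) = (\<integral>\<^sup>+z. indicator U (z - 0) \<partial>M)"
      using LIMSEQ_unique[OF tend[of x, unfolded const[of _ x]] tend[of 0]] .
    also have "\<dots> = emeasure M U" by simp
    also have "(\<integral>\<^sup>+z. indicator U (z - x) \<partial>M) = (\<integral>\<^sup>+z. indicator U z \<partial>(distr M borel (\<lambda>z. z - x)))"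
      by (subst nn_integral_distr) auto
    also have "\<dots> = emeasure (distr M borel (\<lambda>z. z - x)) U" by simp
    finally show ?thesis .
  qed
  let ?E = "range (\<lambda>(a, b). box a b :: 'a set)"
  show ?thesis
  proof (rule measure_eqI_generator_eq[of ?E UNIV])
    show "Int_stable ?E"
      by (auto simp: Int_stable_def box_Int_box)
    show "sets (distr M borel (\<lambda>z. z - x)) = sigma_sets UNIV ?E" "sets M = sigma_sets UNIV ?E"
      by (simp_all add: borel_eq_box sets_M)
    show "(\<Union>n. box (- (real n *\<^sub>R One)) (real n *\<^sub>R One)) = (UNIV :: 'a set)"
      by (rule UN_box_eq_UNIV)
    show "emeasure (distr M borel (\<lambda>z. z - x)) (box (- (real n *\<^sub>R One)) (real n *\<^sub>R One)) \<noteq> \<infinity>" for n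
    proof -
      obtain R where "box (- (real n *\<^sub>R One)) (real n *\<^sub>R One) \<subseteq> ball (0::'a) R"
        using bounded_box bounded_subset_ballD by blast
      hence "emeasure M (box (- (real n *\<^sub>R One)) (real n *\<^sub>R One)) \<le> emeasure M (ball 0 R)"
        by (intro emeasure_mono) (auto simp: sets_M)
      thus ?thesis
        using doubling_measure_ball_finite[OF dbl, of 0 R] open_eq[OF open_box bounded_box, of x] by (simp add: less_top)
    qed
  qed (auto intro!: open_eq open_box bounded_box)
qed

text \<open>
  Uniqueness of Haar measure, by computing the integral of \<open>1_A(x) 1_B(y - x)\<close> over all \<open>(x, y)\<close>, with \<open>B\<close>
  the unit ball, in two ways: directly, and after the substitution \<open>x \<mapsto> x + y\<close>, which the invariance
  of \<open>M\<close> permits.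
\<close>
lemma translation_invariant_eq_lborel:
  fixes M :: "'a::euclidean_space measure"
  assumes "sigma_finite_measure M" and sets_M [measurable_cong]: "sets M = sets borel"
    and inv: "\<And>x. distr M borel (\<lambda>z. z - x) = M" and A [measurable]: "A \<in> sets borel"
  shows "emeasure M A * emeasure lborel (ball (0::'a) 1) = emeasure M (ball 0 1) * emeasure lborel A"
proof -
  interpret M: sigma_finite_measure M by fact
  interpret P: pair_sigma_finite lborel M ..
  let ?A = "indicator A :: 'a \<Rightarrow> ennreal" and ?B = "indicator (ball 0 1) :: 'a \<Rightarrow> ennreal"
  have shift_M: "(\<integral>\<^sup>+x. f (x - y) \<partial>M) = (\<integral>\<^sup>+x. f x \<partial>M)" if [measurable]: "f \<in> borel_measurable borel" for f :: "'a \<Rightarrow> ennreal" and y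
    by (subst (2) inv[of y, symmetric]) (simp add: nn_integral_distr)
  have "emeasure M A * emeasure lborel (ball (0::'a) 1) = (\<integral>\<^sup>+x. ?A x * emeasure lborel (ball (0::'a) 1) \<partial>M)"
    by (subst nn_integral_multc) (auto simp: sets_M)
  also have "\<dots> = (\<integral>\<^sup>+x. \<integral>\<^sup>+y. ?A x * ?B (y - x) \<partial>lborel \<partial>M)"
  proof (intro nn_integral_cong)
    fix x
    have "(\<integral>\<^sup>+y. ?B (y - x) \<partial>lborel) = emeasure lborel (ball (0::'a) 1)"
      using nn_integral_lborel_translate[of ?B "- x"] by simp
    thus "?A x * emeasure lborel (ball (0::'a) 1) = (\<integral>\<^sup>+y. ?A x * ?B (y - x) \<partial>lborel)"
      by (subst nn_integral_cmult) auto
  qed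
  also have "\<dots> = (\<integral>\<^sup>+y. \<integral>\<^sup>+x. ?A x * ?B (y - x) \<partial>M \<partial>lborel)"
    by (rule P.Fubini') measurable
  also have "\<dots> = (\<integral>\<^sup>+y. \<integral>\<^sup>+x. ?A (x + y) * ?B x \<partial>M \<partial>lborel)"
  proof (rule nn_integral_cong)
    fix y
    have "(\<integral>\<^sup>+x. ?A x * ?B (y - x) \<partial>M) = (\<integral>\<^sup>+x. ?A ((x - y) + y) * ?B (x - y) \<partial>M)"
      by (intro nn_integral_cong) (auto simp: indicator_def norm_minus_commute)
    also have "\<dots> = (\<integral>\<^sup>+x. ?A (x + y) * ?B x \<partial>M)"
      by (rule shift_M[of "\<lambda>x. ?A (x + y) * ?B x"]) measurable
    finally show "(\<integral>\<^sup>+x. ?A x * ?B (y - x) \<partial>M) = (\<integral>\<^sup>+x. ?A (x + y) * ?B x \<partial>M)" .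
  qed
  also have "\<dots> = (\<integral>\<^sup>+x. \<integral>\<^sup>+y. ?A (x + y) * ?B x \<partial>lborel \<partial>M)"
    by (rule P.Fubini'[symmetric]) measurable
  also have "\<dots> = (\<integral>\<^sup>+x. emeasure lborel A * ?B x \<partial>M)"
  proof (intro nn_integral_cong)
    fix x
    have "(\<integral>\<^sup>+y. ?A (x + y) \<partial>lborel) = emeasure lborel A"
      using nn_integral_lborel_translate[of ?A x] by simp
    thus "(\<integral>\<^sup>+y. ?A (x + y) * ?B x \<partial>lborel) = emeasure lborel A * ?B x"
      by (subst nn_integral_multc) auto
  qed
  also have "\<dots> = emeasure M (ball 0 1) * emeasure lborel A"
    by (subst nn_integral_cmult) (auto simp: sets_M mult.commute)
  finally show ?thesis .
qed

lemma doubling_minimizers_low_dimension: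
  assumes dim: "DIM('a::euclidean_space) \<le> 2"
  shows "(doubling_minimizers :: 'a measure set) = {scale_measure (ennreal \<alpha>) lborel | \<alpha>::real. \<alpha> > 0}"
proof (intro equalityI subsetI)
  fix M :: "'a measure" assume M: "M \<in> doubling_minimizers"
  hence dbl: "doubling_measure M" by (simp add: doubling_minimizers_iff)
  note sets_M = sets_doubling_measure[OF dbl]
  let ?V = "unit_ball_vol (real DIM('a))"
  have V: "?V > 0" by simp
  hence Vne: "?V \<noteq> 0" by linarith
  obtain c where c: "emeasure M (ball 0 1) = ennreal c" "c \<ge> 0"
    using doubling_measure_ball_finite[OF dbl, of 0 1] by (cases "emeasure M (ball 0 1)") auto
  have "c > 0" using doubling_measure_ball_pos[OF dbl, of 1 0] c by simp
  have "M = scale_measure (ennreal (c / ?V)) lborel"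
  proof (rule measure_eqI)
    show "sets M = sets (scale_measure (ennreal (c / ?V)) lborel)" by (simp add: sets_M)
    fix A assume "A \<in> sets M"
    hence A: "A \<in> sets borel" by (simp add: sets_M)
    have eq: "emeasure M A * ennreal ?V = ennreal c * emeasure lborel A"
      using translation_invariant_eq_lborel[OF sigma_finite_doubling_measure[OF dbl] sets_M
          minimizer_translation_invariant[OF dim M] A]
      by (simp add: c emeasure_ball)
    have "emeasure M A = emeasure M A * ennreal ?V * ennreal (1 / ?V)"
      using Vne by (simp add: mult.assoc flip: ennreal_mult)
    also have "\<dots> = ennreal (c / ?V) * emeasure lborel A"
      unfolding eq using V c by (simp add: divide_inverse ennreal_mult mult_ac)
    finally show "emeasure M A = emeasure (scale_measure (ennreal (c / ?V)) lborel) A"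
      by simp
  qed
  thus "M \<in> {scale_measure (ennreal \<alpha>) lborel | \<alpha>::real. \<alpha> > 0}"
    using \<open>c > 0\<close> V by (intro CollectI exI[of _ "c / ?V"]) simp
next
  fix M :: "'a measure" assume "M \<in> {scale_measure (ennreal \<alpha>) lborel | \<alpha>::real. \<alpha> > 0}"
  then obtain \<alpha> :: real where \<alpha>: "\<alpha> > 0" "M = scale_measure (ennreal \<alpha>) lborel" by blast
  have "(lborel :: 'a measure) \<in> doubling_minimizers"
    by (simp add: doubling_minimizers_iff doubling_measure_lborel emeasure_lborel_ball_double)
  thus "M \<in> doubling_minimizers"
    using cone_of_measures_doubling_minimizers \<alpha> unfolding cone_of_measures_def by blast
qed

section \<open>Dimension at least three\<close>

text \<open>
  The mass of \<open>B(x, r)\<close> is \<open>r^n\<close> times a quantity that decreases in \<open>r\<close>, so doubling the radius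
  multiplies it by at most \<open>2^n\<close>.
\<close>
lemma superharmonic_density_doubling_minimizer:
  fixes f :: "'a::euclidean_space \<Rightarrow> real"
  assumes C2: "C2_function f gr hs" and super: "\<And>x. C2_function.laplacian hs x \<le> 0" and pos: "\<And>x. f x > 0"
  shows "density lborel (\<lambda>x. ennreal (f x)) \<in> doubling_minimizers"
proof -
  have cont: "continuous_on UNIV f" by (rule C2_function.continuous_f[OF C2])
  hence [measurable]: "f \<in> borel_measurable borel" by (rule borel_measurable_continuous_onI)
  let ?M = "density lborel (\<lambda>x. ennreal (f x))" and ?A = "C2_function.unit_ball_integral f"
  have eq: "emeasure ?M (ball x r) = ennreal (r ^ DIM('a) * ?A x r)" if "r > 0" for x r
    using nn_integral_ball_eq_unit_ball_integral[OF cont less_imp_le[OF pos] that, of x]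
    by (simp add: emeasure_density C2_function.unit_ball_integral_def[OF C2])
  show ?thesis
  proof (rule doubling_minimizersI[of _ 1 0])
    fix x :: 'a and r :: real assume r: "r > 0"
    have "(2 * r) ^ DIM('a) * ?A x (2 * r) \<le> (2 * r) ^ DIM('a) * ?A x r"
      using r by (intro mult_left_mono C2_function.unit_ball_integral_mono_superharmonic[OF C2 super]) auto
    also have "\<dots> = 2 ^ DIM('a) * (r ^ DIM('a) * ?A x r)"
      by (simp add: power_mult_distrib)
    finally show "emeasure ?M (ball x (2 * r)) \<le> ennreal (2 ^ DIM('a)) * emeasure ?M (ball x r)"
      using r by (simp add: eq ennreal_leI flip: ennreal_mult')
  next
    have ne: "ennreal (f x) \<noteq> 0" for x
      using pos[of x] by simp
    show "0 < emeasure ?M (ball 0 1)"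
    proof (rule ccontr)
      assume "\<not> 0 < emeasure ?M (ball 0 1)"
      hence "(\<integral>\<^sup>+x. ennreal (f x) * indicator (ball 0 1) x \<partial>lborel) = 0"
        by (simp add: emeasure_density)
      hence "AE x in lborel. ennreal (f x) * indicator (ball 0 1) x = 0"
        by (subst (asm) nn_integral_0_iff_AE) auto
      hence "AE x in lborel. x \<notin> ball (0::'a) 1"
        by (rule eventually_mono) (use ne in \<open>auto simp: indicator_def split: if_splits\<close>)
      thus False using not_AE_not_in_ball[of 1 "0::'a"] zero_less_one by blast
    qed
  qed (simp_all add: eq)
qed

text \<open>
  Smoothed powers of \<open>|x|\<close>; for \<open>n = 3\<close> and \<open>a = 1 / 2\<close> the Newtonian potential with its pole removed.
\<close>
definition radial_power :: "real \<Rightarrow> 'a::euclidean_space \<Rightarrow> real" where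
  "radial_power a x = (1 + x \<bullet> x) powr (- a)"

definition radial_power_measure :: "real \<Rightarrow> 'a::euclidean_space measure" where
  "radial_power_measure a = density lborel (\<lambda>x. ennreal (radial_power a x))"

lemma radial_power_pos: "radial_power a x > 0"
  unfolding radial_power_def powr_gt_zero
  by (metis add_pos_nonneg inner_ge_zero less_numeral_extra(1) less_irrefl)

lemma continuous_radial_power: "continuous_on S (radial_power a)"
  unfolding radial_power_def[abs_def]
  by (intro continuous_intros ballI) (metis add_pos_nonneg inner_ge_zero less_numeral_extra(1) less_irrefl)

lemma measurable_radial_power [measurable]: "radial_power a \<in> borel_measurable borel"
  by (rule borel_measurable_continuous_onI[OF continuous_radial_power])

text \<open>
  With \<open>s = |x|^2\<close> the Laplacian has the sign of \<open>2 (a + 1) s - n (1 + s)\<close>, and \<open>2 (a + 1) \<le> 3 \<le> n\<close>.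
\<close>
lemma radial_power_measure_minimizer:
  assumes dim: "DIM('a::euclidean_space) \<ge> 3" and a: "0 < a" "a \<le> 1 / 2"
  shows "(radial_power_measure a :: 'a measure) \<in> doubling_minimizers"
proof -
  define G where "G = (\<lambda>s::real. (1 + s) powr (- a))"
  define G1 where "G1 = (\<lambda>s::real. - a * (1 + s) powr (- a - 1))"
  define G2 where "G2 = (\<lambda>s::real. a * (a + 1) * (1 + s) powr (- a - 2))"
  have d1: "(G has_real_derivative G1 s) (at s)" if "s \<ge> 0" for s
    unfolding G_def G1_def using that by (auto intro!: derivative_eq_intros)
  have d2: "(G1 has_real_derivative G2 s) (at s)" if "s \<ge> 0" for s
  proof -
    have "((\<lambda>s. (1 + s) powr (- a - 1)) has_real_derivative (- a - 1) * (1 + s) powr (- a - 1 - 1)) (at s)"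
      using that by (auto intro!: derivative_eq_intros)
    from DERIV_cmult[OF this, of "- a"] show ?thesis
      unfolding G1_def G2_def by (simp add: algebra_simps)
  qed
  have cont: "continuous_on {0..} G2"
    unfolding G2_def by (intro continuous_intros) auto
  have C2: "C2_function (\<lambda>x::'a. G (x \<bullet> x)) (\<lambda>x. (2 * G1 (x \<bullet> x)) *\<^sub>R x) (radial_hessian G1 G2)"
    by (rule C2_function_radial(1)[OF d1 d2 cont])
  have "density lborel (\<lambda>x::'a. ennreal (G (x \<bullet> x))) \<in> doubling_minimizers"
  proof (rule superharmonic_density_doubling_minimizer[OF C2])
    fix x :: 'a
    define s where "s = x \<bullet> x"
    have s: "s \<ge> 0" by (simp add: s_def)
    define q where "q = (1 + s) powr (- a - 2)"
    have q: "(1 + s) powr (- a - 1) = (1 + s) * q"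
    proof -
      have "- a - 1 = 1 + (- a - 2)" by simp
      thus ?thesis using s by (simp only: q_def powr_add) simp
    qed
    have "C2_function.laplacian (radial_hessian G1 G2) x = 2 * DIM('a) * G1 s + 4 * s * G2 s"
      unfolding s_def by (rule C2_function_radial(2)[OF d1 d2 cont])
    also have "\<dots> = 2 * a * q * (2 * (a + 1) * s - DIM('a) * (1 + s))"
      unfolding G1_def G2_def q q_def[symmetric] by (simp add: algebra_simps)
    also have "\<dots> \<le> 0"
    proof (rule mult_nonneg_nonpos)
      have "2 * (a + 1) * s \<le> 3 * s" using a s by (intro mult_right_mono) auto
      also have "\<dots> \<le> DIM('a) * (1 + s)"
        using dim s by (intro mult_mono) auto
      finally show "2 * (a + 1) * s - DIM('a) * (1 + s) \<le> 0" by simp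
    qed (use a in \<open>simp add: q_def\<close>)
    finally show "C2_function.laplacian (radial_hessian G1 G2) x \<le> 0" .
  next
    fix x :: 'a show "G (x \<bullet> x) > 0"
      using radial_power_pos[of a x] by (simp add: G_def radial_power_def)
  qed
  thus ?thesis
    by (simp add: radial_power_measure_def radial_power_def G_def)
qed

text \<open>Multiplied by \<open>t^m\<close>, with \<open>m\<close> the least \<open>a\<close> of nonzero coefficient, the sum tends to the coefficient of \<open>m\<close>.\<close>
lemma powr_sum_eq_0_imp:
  fixes c :: "real \<Rightarrow> real"
  assumes fin: "finite I" and zero: "\<And>t. t \<ge> 1 \<Longrightarrow> (\<Sum>a\<in>I. c a * t powr (- a)) = 0" and a: "a \<in> I"
  shows "c a = 0"
proof (rule ccontr)
  assume "c a \<noteq> 0"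
  define J where "J = {a \<in> I. c a \<noteq> 0}"
  have J: "finite J" "J \<noteq> {}" using fin a \<open>c a \<noteq> 0\<close> by (auto simp: J_def)
  define m where "m = Min J"
  have m: "m \<in> J" "\<And>b. b \<in> J \<Longrightarrow> m \<le> b" using J by (auto simp: m_def)
  have lim: "((\<lambda>t. c m + (\<Sum>b\<in>J - {m}. c b * t powr (m - b))) \<longlongrightarrow> c m + (\<Sum>b\<in>J - {m}. c b * 0)) at_top"
  proof (intro tendsto_intros tendsto_neg_powr filterlim_ident)
    show "m - b < 0" if "b \<in> J - {m}" for b using m(2)[of b] that by force
  qed
  have "eventually (\<lambda>t. c m + (\<Sum>b\<in>J - {m}. c b * t powr (m - b)) = 0) at_top"
    using eventually_ge_at_top[of 1]
  proof eventually_elim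
    case (elim t)
    have "c m + (\<Sum>b\<in>J - {m}. c b * t powr (m - b)) = (\<Sum>b\<in>J. c b * t powr (m - b))"
      using elim by (simp only: sum.remove[OF J(1) m(1)]) simp
    also have "\<dots> = (\<Sum>b\<in>I. c b * t powr (m - b))"
      using fin by (intro sum.mono_neutral_left) (auto simp: J_def)
    also have "\<dots> = t powr m * (\<Sum>b\<in>I. c b * t powr (- b))"
      unfolding sum_distrib_left
    proof (rule sum.cong[OF refl])
      fix b
      have "t powr (m - b) = t powr m * t powr (- b)"
        using powr_add[of t m "- b"] by simp
      thus "c b * t powr (m - b) = t powr m * (c b * t powr (- b))" by simp
    qed
    finally show ?case using zero[OF elim] by simp
  qed
  from tendsto_eventually[OF this] lim have "c m + (\<Sum>b\<in>J - {m}. c b * 0) = 0"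
    by (rule tendsto_unique[OF trivial_limit_at_top_linorder, rotated])
  hence "c m = 0" by simp
  thus False using m(1) by (simp add: J_def)
qed

lemma measure_radial_power_measure_ball:
  "measure (radial_power_measure a) (ball p r) = (\<integral>y. indicator (ball p r) y * radial_power a y \<partial>(lborel :: 'a::euclidean_space measure))"
proof -
  have "emeasure (radial_power_measure a) (ball p r) = (\<integral>\<^sup>+y. ennreal (radial_power a y) * indicator (ball p r) y \<partial>lborel)"
    unfolding radial_power_measure_def by (rule emeasure_density) auto
  also have "\<dots> = (\<integral>\<^sup>+y. ennreal (indicator (ball p r) y * radial_power a y) \<partial>lborel)"
    by (intro nn_integral_cong) (auto simp: indicator_def)
  also have "\<dots> = ennreal (\<integral>y. indicator (ball p r) y * radial_power a y \<partial>lborel)"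
    by (intro nn_integral_eq_integral integrable_indicator_ball_continuous_on continuous_radial_power)
       (auto simp: indicator_def less_imp_le[OF radial_power_pos])
  finally show ?thesis
    by (simp add: measure_def less_imp_le[OF radial_power_pos])
qed

lemma continuous_eq_0_of_ball_integrals:
  fixes h :: "'a::euclidean_space \<Rightarrow> real"
  assumes cont: "continuous_on UNIV h" and zero: "\<And>p r. (\<integral>y. indicator (ball p r) y * h y \<partial>lborel) = 0"
  shows "h x = 0"
proof -
  have not_pos: "\<not> g x > 0" if g: "continuous_on UNIV g" "\<And>p r. (\<integral>y. indicator (ball p r) y * g y \<partial>lborel) = 0"
    for g :: "'a \<Rightarrow> real"
  proof
    assume "g x > 0"
    moreover have "isCont g x" using g(1) by (simp add: continuous_on_eq_continuous_at)
    ultimately obtain d where d: "d > 0" "\<And>y. dist y x < d \<Longrightarrow> dist (g y) (g x) < g x"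
      by (auto simp: continuous_at_eps_delta)
    have pos: "g y > 0" if "y \<in> ball x d" for y
      using d(2)[of y] that by (auto simp: dist_commute dist_real_def abs_less_iff)
    have "AE y in lborel. indicator (ball x d) y * g y = 0"
      using g(2)[of x d] integrable_indicator_ball_continuous_on[OF g(1), of x d] pos
      by (subst (asm) integral_nonneg_eq_0_iff_AE) (auto simp: indicator_def less_imp_le)
    hence "AE y in lborel. y \<notin> ball x d"
      by (rule eventually_mono) (use pos in \<open>force simp: indicator_def\<close>)
    thus False using not_AE_not_in_ball[OF d(1)] by blast
  qed
  have "\<not> h x > 0" by (rule not_pos[OF cont zero])
  moreover have "\<not> - h x > 0"
    using zero by (intro not_pos[of "\<lambda>x. - h x"] continuous_intros cont) simp
  ultimately show ?thesis by linarith
qed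

text \<open>
  A vanishing combination of the measures is a vanishing combination of their continuous densities, and
  \<open>1 + |x|^2\<close> takes all values \<open>t \<ge> 1\<close>.
\<close>
lemma radial_power_measures_independent:
  assumes fin: "finite I"
    and zero: "\<And>A. A \<in> sets borel \<Longrightarrow> bounded A \<Longrightarrow>
      (\<Sum>a\<in>I. c a * measure (radial_power_measure a :: 'a::euclidean_space measure) A) = 0"
    and a: "a \<in> I"
  shows "c a = 0"
proof (rule powr_sum_eq_0_imp[OF fin _ a])
  fix t :: real assume t: "t \<ge> 1"
  define h where "h = (\<lambda>x::'a. \<Sum>a\<in>I. c a * radial_power a x)"
  have "h x = 0" for x
  proof (rule continuous_eq_0_of_ball_integrals[of h])
    show "continuous_on UNIV h"
      unfolding h_def by (intro continuous_intros continuous_radial_power)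
    fix p :: 'a and r :: real
    have int: "integrable lborel (\<lambda>y. indicator (ball p r) y * radial_power a y)" for a
      by (intro integrable_indicator_ball_continuous_on continuous_radial_power)
    have "(\<integral>y. indicator (ball p r) y * h y \<partial>lborel)
        = (\<integral>y. (\<Sum>a\<in>I. c a * (indicator (ball p r) y * radial_power a y)) \<partial>lborel)"
      unfolding h_def by (intro Bochner_Integration.integral_cong refl) (simp add: sum_distrib_left mult.left_commute)
    also have "\<dots> = (\<Sum>a\<in>I. \<integral>y. c a * (indicator (ball p r) y * radial_power a y) \<partial>lborel)"
      by (rule Bochner_Integration.integral_sum) (intro integrable_mult_right int)
    also have "\<dots> = (\<Sum>a\<in>I. c a * measure (radial_power_measure a) (ball p r))"
      by (intro sum.cong refl) (simp only: integral_mult_right_zero measure_radial_power_measure_ball)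
    also have "\<dots> = 0" by (rule zero) auto
    finally show "(\<integral>y. indicator (ball p r) y * h y \<partial>lborel) = 0" .
  qed
  moreover obtain b :: 'a where b: "b \<in> Basis" using nonempty_Basis by blast
  ultimately have "h (sqrt (t - 1) *\<^sub>R b) = 0" by blast
  moreover have "1 + (sqrt (t - 1) *\<^sub>R b) \<bullet> (sqrt (t - 1) *\<^sub>R b) = t"
    using b t by (simp add: inner_Basis)
  ultimately show "(\<Sum>a\<in>I. c a * t powr (- a)) = 0"
    by (simp only: h_def radial_power_def)
qed

lemma inj_radial_power_measure: "inj (radial_power_measure :: real \<Rightarrow> 'a::euclidean_space measure)"
proof (rule injI, rule ccontr)
  fix a b assume eq: "radial_power_measure a = (radial_power_measure b :: 'a measure)" and "a \<noteq> b"
  have "(if a = a then 1 else - 1 :: real) = 0"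
    by (rule radial_power_measures_independent[of "{a, b}" "\<lambda>x. if x = a then 1 else - 1" a, where 'a = 'a])
       (use eq \<open>a \<noteq> b\<close> in auto)
  thus False by simp
qed

lemma doubling_minimizers_infinite_dimensional:
  assumes dim: "DIM('a::euclidean_space) \<ge> 3"
  shows "infinite_dimensional_cone (doubling_minimizers :: 'a measure set)"
  unfolding infinite_dimensional_cone_def
proof (intro conjI exI cone_of_measures_doubling_minimizers allI impI)
  let ?S = "(radial_power_measure :: real \<Rightarrow> 'a measure) ` {0<..1 / 2}"
  have inj: "inj_on (radial_power_measure :: real \<Rightarrow> 'a measure) I" for I
    using inj_radial_power_measure by (rule inj_on_subset) simp
  show "?S \<subseteq> doubling_minimizers"
    using radial_power_measure_minimizer[OF dim] by auto
  show "infinite ?S"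
    using inj by (simp add: finite_image_iff)
  fix F assume "F \<subseteq> ?S" and "finite F"
  then obtain I where I: "finite I" "F = radial_power_measure ` I"
    by (meson finite_subset_image)
  show "independent_measures F"
    unfolding independent_measures_def
  proof (intro allI impI ballI)
    fix c :: "'a measure \<Rightarrow> real" and M
    assume zero: "\<forall>A\<in>sets borel. bounded A \<longrightarrow> (\<Sum>M\<in>F. c M * measure M A) = 0" and "M \<in> F"
    then obtain a where a: "a \<in> I" "M = radial_power_measure a" using I by auto
    have "c (radial_power_measure a) = 0"
    proof (rule radial_power_measures_independent[OF I(1) _ a(1), of "\<lambda>a. c (radial_power_measure a)"])
      fix A :: "'a set" assume "A \<in> sets borel" "bounded A"
      hence "(\<Sum>M\<in>F. c M * measure M A) = 0" using zero by blast
      thus "(\<Sum>a\<in>I. c (radial_power_measure a) * measure (radial_power_measure a) A) = 0"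
        unfolding I(2) sum.reindex[OF inj] o_def .
    qed
    thus "c M = 0" by (simp add: a)
  qed
qed

theorem theorem1:
  shows "(CARD('n::finite) \<in> {1, 2} \<longrightarrow>
            (doubling_minimizers :: (real ^ 'n) measure set) =
              {scale_measure (ennreal \<alpha>) lborel | \<alpha>::real. \<alpha> > 0}) \<and>
         (CARD('n) \<ge> 3 \<longrightarrow>
            infinite_dimensional_cone (doubling_minimizers :: (real ^ 'n) measure set))"
proof (intro conjI impI)
  assume "CARD('n) \<in> {1, 2}"
  hence "DIM(real ^ 'n) \<le> 2" by auto
  thus "(doubling_minimizers :: (real ^ 'n) measure set) =
              {scale_measure (ennreal \<alpha>) lborel | \<alpha>::real. \<alpha> > 0}"
    by (rule doubling_minimizers_low_dimension)
next
  assume "CARD('n) \<ge> 3"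
  thus "infinite_dimensional_cone (doubling_minimizers :: (real ^ 'n) measure set)"
    by (intro doubling_minimizers_infinite_dimensional) simp
qed

end
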